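(* Let $\mathcal{E}$ be a regular conservative Dirichlet form on $L^2(m)$ with associated semigroup $(P_t)_{t\ge0}$, and let $p\in(1,\infty)$. Assume that $(P_t)_{t\ge0}$ is strongly stable on $L^p(m)$, i.e., for every $f\in L^p(m)$, $\|P_Tf\|_p\to0$ as $T\to\infty$. Then for every $f\in L^p(m)$, $$\int_E|f|^p\,dm=p\int_0^\infty\mathcal{E}_p[P_tf]\,dt,$$ where $\mathcal{E}_p$ is the $p$-form corresponding to $\mathcal{E}$.
   Context: $E$ is a locally compact separable metric space with Borel $\sigma$-algebra $\mathcal{B}$, and $m$ is a positive Radon measure on $E$ with $\mathrm{supp}(m)=E$. Write $L^p(m):=L^p(E,\mathcal{B},m)$ with norm $\|\cdot\|_p$. $(P_t)_{t\ge0}$ is the strongly continuous symmetric Markovian semigroup of contractions on $L^2(m)$ associated with $\mathcal{E}$; it extends to a strongly continuous semigroup of contractions on $L^p(m)$ for every $p\in[1,\infty)$. Conservative means $P_t1=1$ for all $t\geq 0$. For real $a$ and $\kappa>0$, $a^{\langle\kappa\rangle}:=|a|^\kappa\,\mathrm{sgn}\,a$. For $u\in L^p(m)$, $v\in L^q(m)$ with $p^{-1}+q^{-1}=1$, put $\langle u,v\rangle:=\int_E uv\,dm$ and, for $t>0$, $\mathcal{E}^{(t)}(u,v):=\frac1t\langle u-P_tu,v\rangle$. The $p$-form is the nonlinear functional $$\mathcal{E}_p[u]:=\lim_{t\to0^+}\mathcal{E}^{(t)}\left(u,u^{\langle p-1\rangle}\right),$$ with domain $\mathcal{D}(\mathcal{E}_p)$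 consisting of all $u\in L^p(m)$ for which this limit exists and is finite. (For $f\in L^p(m)$ and $t>0$ one has $P_tf\in\mathcal{D}(\mathcal{E}_p)$, so the integrand on the right-hand side is defined for all $t>0$.) *)

theory Defs
  imports "HOL-Analysis.Analysis"
begin

section \<open>Measures on a metric space\<close>

definition radon_measure :: "'a::metric_space measure \<Rightarrow> bool" where
  "radon_measure m \<longleftrightarrow>
     sets m = sets borel \<and>
     (\<forall>K. compact K \<longrightarrow> emeasure m K < \<infinity>) \<and>
     (\<forall>A\<in>sets borel. emeasure m A = (SUP K\<in>{K. compact K \<and> K \<subseteq> A}. emeasure m K))"

definition measure_support :: "'a::metric_space measure \<Rightarrow> 'a set" where
  "measure_support m = {x. \<forall>U. open U \<and> x \<in> U \<longrightarrow> emeasure m U > 0}"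


section \<open>The spaces \<open>L\<^sup>p(m)\<close>\<close>

text \<open>Elements of \<open>L\<^sup>p(m)\<close> are represented by functions rather than by classes of functions.
  Accordingly, below, equalities and order relations between elements of \<open>L\<^sup>p(m)\<close> are stated
  almost everywhere, and operators are only determined up to null sets.\<close>

definition Lp :: "'a measure \<Rightarrow> real \<Rightarrow> ('a \<Rightarrow> real) set" where
  "Lp m p = {f \<in> borel_measurable m. integrable m (\<lambda>x. \<bar>f x\<bar> powr p)}"

definition Lp_norm :: "'a measure \<Rightarrow> real \<Rightarrow> ('a \<Rightarrow> real) \<Rightarrow> real" where
  "Lp_norm m p f = (\<integral>x. \<bar>f x\<bar> powr p \<partial>m) powr (1 / p)"

definition pairing :: "'a measure \<Rightarrow> ('a \<Rightarrow> real) \<Rightarrow> ('a \<Rightarrow> real) \<Rightarrow> real" where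
  "pairing m u v = (\<integral>x. u x * v x \<partial>m)"


section \<open>Semigroups\<close>

text \<open>Linearity and contractivity together imply that \<open>T t\<close> respects equality almost
  everywhere, i.e. that it is well defined on classes.\<close>

definition sc_contraction_semigroup ::
    "'a measure \<Rightarrow> real \<Rightarrow> (real \<Rightarrow> ('a \<Rightarrow> real) \<Rightarrow> 'a \<Rightarrow> real) \<Rightarrow> bool" where
  "sc_contraction_semigroup m p T \<longleftrightarrow>
     (\<forall>t\<ge>0. \<forall>f\<in>Lp m p. T t f \<in> Lp m p) \<and>
     (\<forall>t\<ge>0. \<forall>f\<in>Lp m p. \<forall>g\<in>Lp m p. \<forall>a b.
        AE x in m. T t (\<lambda>y. a * f y + b * g y) x = a * T t f x + b * T t g x) \<and>
     (\<forall>t\<ge>0. \<forall>f\<in>Lp m p. Lp_norm m p (T t f) \<le> Lp_norm m p f) \<and>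
     (\<forall>f\<in>Lp m p. AE x in m. T 0 f x = f x) \<and>
     (\<forall>s\<ge>0. \<forall>t\<ge>0. \<forall>f\<in>Lp m p. AE x in m. T (s + t) f x = T s (T t f) x) \<and>
     (\<forall>f\<in>Lp m p. ((\<lambda>t. Lp_norm m p (\<lambda>x. T t f x - f x)) \<longlongrightarrow> 0) (at_right 0))"

definition symmetric_semigroup ::
    "'a measure \<Rightarrow> (real \<Rightarrow> ('a \<Rightarrow> real) \<Rightarrow> 'a \<Rightarrow> real) \<Rightarrow> bool" where
  "symmetric_semigroup m T \<longleftrightarrow>
     (\<forall>t\<ge>0. \<forall>f\<in>Lp m 2. \<forall>g\<in>Lp m 2. pairing m (T t f) g = pairing m f (T t g))"

definition markovian_semigroup ::
    "'a measure \<Rightarrow> (real \<Rightarrow> ('a \<Rightarrow> real) \<Rightarrow> 'a \<Rightarrow> real) \<Rightarrow> bool" where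
  "markovian_semigroup m T \<longleftrightarrow>
     (\<forall>t\<ge>0. \<forall>f\<in>Lp m 2. (AE x in m. 0 \<le> f x \<and> f x \<le> 1) \<longrightarrow>
        (AE x in m. 0 \<le> T t f x \<and> T t f x \<le> 1))"

text \<open>A Markovian semigroup on \<open>L\<^sup>2(m)\<close> extends to the nonnegative elements of
  \<open>L\<^sup>\<infinity>(m)\<close> by monotone approximation from \<open>L\<^sup>2(m)\<close>. The following says that
  \<open>g\<close> is (a version of) the value at \<open>f\<close> of the operator extended in this way; when \<open>m\<close> is
  \<open>\<sigma>\<close>-finite, approximating sequences exist and all of them give the same limit.\<close>

definition Linf_extension_value ::
    "'a measure \<Rightarrow> (('a \<Rightarrow> real) \<Rightarrow> 'a \<Rightarrow> real) \<Rightarrow> ('a \<Rightarrow> real) \<Rightarrow> ('a \<Rightarrow> real) \<Rightarrow> bool" where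
  "Linf_extension_value m S f g \<longleftrightarrow>
     (\<forall>u. (\<forall>n::nat. u n \<in> Lp m 2) \<and>
          (\<forall>n. AE x in m. 0 \<le> u n x \<and> u n x \<le> u (Suc n) x) \<and>
          (AE x in m. (\<lambda>n. u n x) \<longlonglongrightarrow> f x)
        \<longrightarrow> (AE x in m. (\<lambda>n. S (u n) x) \<longlonglongrightarrow> g x))"

definition conservative ::
    "'a measure \<Rightarrow> (real \<Rightarrow> ('a \<Rightarrow> real) \<Rightarrow> 'a \<Rightarrow> real) \<Rightarrow> bool" where
  "conservative m T \<longleftrightarrow> (\<forall>t\<ge>0. Linf_extension_value m (T t) (\<lambda>_. 1) (\<lambda>_. 1))"


section \<open>Dirichlet forms\<close>

definition form_1 ::
    "'a measure \<Rightarrow> (('a \<Rightarrow> real) \<Rightarrow> ('a \<Rightarrow> real) \<Rightarrow> real) \<Rightarrow> ('a \<Rightarrow> real) \<Rightarrow> ('a \<Rightarrow> real) \<Rightarrow> real"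
  where "form_1 m \<E> u v = \<E> u v + pairing m u v"

text \<open>A form is given by its domain \<open>D\<close> and its values \<open>\<E> u v\<close> for \<open>u, v \<in> D\<close>;
  \<open>\<E>\<close> is irrelevant outside \<open>D\<close>. The second and third conditions say that domain and
  form only depend on classes of functions. The last three conditions are density of the domain,
  closedness, and the Markov property (the unit contraction operates on the form).\<close>

definition dirichlet_form ::
    "'a measure \<Rightarrow> ('a \<Rightarrow> real) set \<Rightarrow> (('a \<Rightarrow> real) \<Rightarrow> ('a \<Rightarrow> real) \<Rightarrow> real) \<Rightarrow> bool" where
  "dirichlet_form m D \<E> \<longleftrightarrow>
     D \<subseteq> Lp m 2 \<and>
     (\<forall>u\<in>D. \<forall>v\<in>Lp m 2. (AE x in m. u x = v x) \<longrightarrow> v \<in> D) \<and>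
     (\<forall>u\<in>D. \<forall>u'\<in>D. \<forall>v\<in>D. (AE x in m. u x = u' x) \<longrightarrow> \<E> u v = \<E> u' v) \<and>
     (\<forall>u\<in>D. \<forall>v\<in>D. \<forall>a b. (\<lambda>x. a * u x + b * v x) \<in> D) \<and>
     (\<forall>u\<in>D. \<forall>v\<in>D. \<forall>w\<in>D. \<forall>a b. \<E> (\<lambda>x. a * u x + b * v x) w = a * \<E> u w + b * \<E> v w) \<and>
     (\<forall>u\<in>D. \<forall>v\<in>D. \<E> u v = \<E> v u) \<and>
     (\<forall>u\<in>D. 0 \<le> \<E> u u) \<and>
     (\<forall>f\<in>Lp m 2. \<forall>\<epsilon>>0. \<exists>u\<in>D. Lp_norm m 2 (\<lambda>x. f x - u x) < \<epsilon>) \<and>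
     (\<forall>u. (\<forall>n::nat. u n \<in> D) \<and>
          (\<forall>\<epsilon>>0. \<exists>N. \<forall>j\<ge>N. \<forall>k\<ge>N.
             form_1 m \<E> (\<lambda>x. u j x - u k x) (\<lambda>x. u j x - u k x) < \<epsilon>)
        \<longrightarrow> (\<exists>w\<in>D. (\<lambda>n. form_1 m \<E> (\<lambda>x. u n x - w x) (\<lambda>x. u n x - w x)) \<longlonglongrightarrow> 0)) \<and>
     (\<forall>u\<in>D. (\<lambda>x. min (max (u x) 0) 1) \<in> D \<and>
        \<E> (\<lambda>x. min (max (u x) 0) 1) (\<lambda>x. min (max (u x) 0) 1) \<le> \<E> u u)"

definition C_c :: "('a::metric_space \<Rightarrow> real) set" where
  "C_c = {\<phi>. continuous_on UNIV \<phi> \<and> compact (closure {x. \<phi> x \<noteq> 0})}"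

definition regular_dirichlet_form ::
    "'a::metric_space measure \<Rightarrow> ('a \<Rightarrow> real) set \<Rightarrow> (('a \<Rightarrow> real) \<Rightarrow> ('a \<Rightarrow> real) \<Rightarrow> real) \<Rightarrow> bool"
  where
  "regular_dirichlet_form m D \<E> \<longleftrightarrow>
     dirichlet_form m D \<E> \<and>
     (\<forall>u\<in>D. \<forall>\<epsilon>>0. \<exists>\<phi>\<in>D \<inter> C_c. form_1 m \<E> (\<lambda>x. u x - \<phi> x) (\<lambda>x. u x - \<phi> x) < \<epsilon>) \<and>
     (\<forall>\<phi>\<in>C_c. \<forall>\<epsilon>>0. \<exists>u\<in>D \<inter> C_c. \<forall>x. \<bar>\<phi> x - u x\<bar> < \<epsilon>)"


section \<open>The semigroup associated with a form, and the \<open>p\<close>-form\<close>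

definition approx_form :: "'a measure \<Rightarrow> (real \<Rightarrow> ('a \<Rightarrow> real) \<Rightarrow> 'a \<Rightarrow> real) \<Rightarrow>
    real \<Rightarrow> ('a \<Rightarrow> real) \<Rightarrow> ('a \<Rightarrow> real) \<Rightarrow> real" where
  "approx_form m P t u v = (1 / t) * pairing m (\<lambda>x. u x - P t u x) v"

text \<open>One family \<open>P\<close> stands for the semigroup on \<open>L\<^sup>2(m)\<close> and for its extensions to all
  \<open>L\<^sup>q(m)\<close>, \<open>1 \<le> q < \<infinity>\<close>; the extensions are determined by \<open>P\<close> on \<open>L\<^sup>2(m)\<close>, as
  \<open>L\<^sup>2(m) \<inter> L\<^sup>q(m)\<close> is dense in \<open>L\<^sup>q(m)\<close>. The semigroup and the form are linked by
  \<open>\<E>(u,v) = lim \<E>\<^sup>(\<^sup>t\<^sup>)(u,v)\<close> as \<open>t \<rightarrow> 0+\<close>, the domain being the set of all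
  \<open>u \<in> L\<^sup>2(m)\<close> for which \<open>\<E>\<^sup>(\<^sup>t\<^sup>)(u,u)\<close> has a finite limit.\<close>

definition associated_semigroup :: "'a measure \<Rightarrow> ('a \<Rightarrow> real) set \<Rightarrow>
    (('a \<Rightarrow> real) \<Rightarrow> ('a \<Rightarrow> real) \<Rightarrow> real) \<Rightarrow> (real \<Rightarrow> ('a \<Rightarrow> real) \<Rightarrow> 'a \<Rightarrow> real) \<Rightarrow> bool" where
  "associated_semigroup m D \<E> P \<longleftrightarrow>
     (\<forall>q\<ge>1. sc_contraction_semigroup m q P) \<and>
     symmetric_semigroup m P \<and>
     markovian_semigroup m P \<and>
     D = {u \<in> Lp m 2. \<exists>l. ((\<lambda>t. approx_form m P t u u) \<longlongrightarrow> l) (at_right 0)} \<and>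
     (\<forall>u\<in>D. \<forall>v\<in>D. ((\<lambda>t. approx_form m P t u v) \<longlongrightarrow> \<E> u v) (at_right 0))"

definition signed_powr :: "real \<Rightarrow> real \<Rightarrow> real" where
  "signed_powr a \<kappa> = \<bar>a\<bar> powr \<kappa> * sgn a"

definition p_form_domain :: "'a measure \<Rightarrow> (real \<Rightarrow> ('a \<Rightarrow> real) \<Rightarrow> 'a \<Rightarrow> real) \<Rightarrow>
    real \<Rightarrow> ('a \<Rightarrow> real) set" where
  "p_form_domain m P p =
     {u \<in> Lp m p. \<exists>l. ((\<lambda>t. approx_form m P t u (\<lambda>x. signed_powr (u x) (p - 1))) \<longlongrightarrow> l) (at_right 0)}"

definition p_form :: "'a measure \<Rightarrow> (real \<Rightarrow> ('a \<Rightarrow> real) \<Rightarrow> 'a \<Rightarrow> real) \<Rightarrow>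
    real \<Rightarrow> ('a \<Rightarrow> real) \<Rightarrow> real" where
  "p_form m P p u = Lim (at_right 0) (\<lambda>t. approx_form m P t u (\<lambda>x. signed_powr (u x) (p - 1)))"

end

theory Submission
  imports Defs "HOL-Complex_Analysis.Complex_Analysis"
begin

text \<open>
  The identity is the integrated form of \<open>d/dt \<integral>\<bar>P t f\<bar>\<^sup>p dm = - p E\<^sub>p[P t f]\<close>, where \<open>E\<^sub>p\<close> is the \<open>p\<close>-form.
  Convexity of \<open>\<bar>w\<bar>\<^sup>p\<close> compares the increments of the norm with pairings \<open>\<langle>P y f - P t f, g\<rangle>\<close>, where
  \<open>g = (P t f)\<^sup>\<langle>\<^sup>p\<^sup>-\<^sup>1\<^sup>\<rangle>\<close>, and the same pairings, divided by the time difference, define the \<open>p\<close>-form at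
  \<open>P t f\<close>. What has to be shown is that \<open>y \<mapsto> \<langle>P y f, g\<rangle>\<close> is differentiable at positive times, with an error that is
  quadratic uniformly in \<open>g\<close>. This is a weak form of the analyticity of symmetric
  Markovian semigroups on \<open>L\<^sup>p\<close> for \<open>1 < p < \<infinity>\<close>, and it is obtained directly, without complex interpolation.

  The core is a two-point inequality (\<open>two_point_contraction\<close>): for \<open>\<eta> = z / (2 (1 + z))\<close> with \<open>z\<close> in a sector
  around the positive axis, \<open>(a, b) \<mapsto> ((1 - \<eta>) a + \<eta> b, (1 - \<eta>) b + \<eta> a)\<close> is a contraction of the two-dimensional
  complex \<open>l\<^sup>p\<close> space. Since a symmetric sub-Markovian operator \<open>T\<close> acts on simple functions as a
  symmetric matrix with nonnegative entries, Jensen's inequality transfers this to \<open>(1 - \<eta>) + \<eta> T\<close> on complex \<open>L\<^sup>p\<close>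
  (\<open>two_point_step\<close>). Taking \<open>T = P (1 / N)\<close> and the power \<open>2 N\<^sup>2\<close> yields functions of \<open>\<zeta> = N z\<close>
  that are holomorphic, bounded in the sector uniformly in \<open>N\<close>, and equal to Bernstein-type
  averages of \<open>r \<mapsto> \<langle>P r f, g\<rangle>\<close> for real \<open>\<zeta>\<close>. They converge on the positive axis, and Cauchy's inequalities carry a
  Taylor estimate to the limit (\<open>sector_bound_imp_differentiable\<close>, \<open>pairing_orbit_differentiable\<close>).

  As a result \<open>- p E\<^sub>p[P t f]\<close> is, up to a quadratic error, a subgradient at \<open>t\<close> of the function
  \<open>t \<mapsto> \<integral>\<bar>P t f\<bar>\<^sup>p\<close> (\<open>orbit_energy\<close>). After adding a quadratic function it becomes an exact subgradient,
  and integrating it gives the increments of the function over compact intervals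
  (\<open>energy_has_integral\<close>). Strong continuity at \<open>0\<close> and stability at infinity give the boundary terms.\<close>

section \<open>A complex two-point inequality\<close>

text \<open>
  Up to the factor \<open>p\<close>, the gradient of \<open>w \<mapsto> \<bar>w\<bar>\<^sup>p\<close> on the plane; on the real line it is
  \<open>signed_powr w (p - 1)\<close>.\<close>
definition dual_power :: "real \<Rightarrow> complex \<Rightarrow> complex" where
  "dual_power p w = of_real (cmod w powr (p - 2)) * w"

text \<open>The tangent of half the opening angle of the sector around the positive axis in which the
  semigroup is shown to stay contractive. It is positive for \<open>1 < p\<close> and at most \<open>1\<close>.\<close>
definition sector_slope :: "real \<Rightarrow> real" where
  "sector_slope p = min (p - 1) (1 / (p - 1))"

lemma sector_slope_pos: "1 < p \<Longrightarrow> 0 < sector_slope p"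
  by (simp add: sector_slope_def)

lemma young_dual:
  fixes a b p :: real
  assumes "1 < p" "0 \<le> a" "0 \<le> b"
  shows "a * b powr (p - 1) \<le> a powr p / p + (1 - 1 / p) * b powr p"
proof -
  define q where "q = p / (p - 1)"
  have q: "q > 1" "1 / p + 1 / q = 1" "(p - 1) * q = p"
    using assms(1) by (simp_all add: q_def field_simps)
  have "a * b powr (p - 1) \<le> a powr p / p + (b powr (p - 1)) powr q / q"
    using Youngs_inequality[of p q a "b powr (p - 1)"] assms q by simp
  also have "(b powr (p - 1)) powr q / q = (1 - 1 / p) * b powr p"
  proof -
    have "1 / q = 1 - 1 / p" using q by simp
    then show ?thesis using q by (metis divide_inverse inverse_eq_divide mult.commute powr_powr)
  qed
  finally show ?thesis .
qed

lemma cmod_dual_power: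
  assumes "1 < p"
  shows "cmod (dual_power p b) = cmod b powr (p - 1)"
proof (cases "b = 0")
  case False
  then have "cmod b powr (p - 2) * cmod b powr 1 = cmod b powr (p - 1)"
    by (simp add: powr_add[symmetric] del: powr_one powr_one')
  then show ?thesis using False by (simp add: dual_power_def norm_mult)
qed (simp add: dual_power_def)

lemma cnj_dual_power_mult_self:
  assumes "1 < p"
  shows "cnj (dual_power p b) * b = of_real (cmod b powr p)"
proof (cases "b = 0")
  case False
  then have "cmod b powr (p - 2) * cmod b powr 2 = cmod b powr p"
    by (simp add: powr_add[symmetric] del: powr_numeral)
  then have "cmod b powr (p - 2) * (cmod b)\<^sup>2 = cmod b powr p" using False by simp
  then show ?thesis
    by (simp add: dual_power_def mult.assoc mult.commute[of "cnj b"] complex_norm_square[symmetric]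
        flip: of_real_mult of_real_power)
qed (use assms in \<open>simp add: dual_power_def\<close>)

text \<open>The tangent plane of the convex function \<open>w \<mapsto> \<bar>w\<bar>\<^sup>p\<close> lies below its graph; this is
  Young's inequality for the cross term. The convexity arguments for \<open>p\<close>-th powers below, from Jensen's inequality to
  the comparison of norms along the orbit, are instances.\<close>
lemma cmod_powr_subgradient:
  assumes "1 < p"
  shows "cmod b powr p + p * Re (cnj (dual_power p b) * (a - b)) \<le> cmod a powr p"
proof -
  have "Re (cnj (dual_power p b) * a) \<le> cmod a * cmod b powr (p - 1)"
    using complex_Re_le_cmod[of "cnj (dual_power p b) * a"]
    by (simp add: norm_mult cmod_dual_power[OF assms] mult.commute)
  also have "\<dots> \<le> cmod a powr p / p + (1 - 1 / p) * cmod b powr p"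
    by (rule young_dual) (use assms in auto)
  finally have "p * Re (cnj (dual_power p b) * a) \<le> cmod a powr p + (p - 1) * cmod b powr p"
    using assms by (simp add: field_simps)
  moreover have "Re (cnj (dual_power p b) * (a - b)) = Re (cnj (dual_power p b) * a) - cmod b powr p"
    by (simp add: right_diff_distrib cnj_dual_power_mult_self[OF assms])
  ultimately show ?thesis by (simp add: algebra_simps)
qed

text \<open>Both \<open>r\<^sup>d - 1\<close> and \<open>r - 1\<close> vanish to first order at \<open>r = 1\<close>; the factor \<open>r\<^sup>d\<close> on the right
  covers large \<open>r\<close> for small and for large exponents alike. After division by \<open>r\<^sup>d\<close> this is
  \<open>1 - exp (- x) \<le> x\<close> with \<open>x = d ln r\<close>, followed by \<open>ln r \<le> r - 1\<close>.\<close>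
lemma powr_minus_one_le:
  fixes r d :: real
  assumes "1 \<le> r" "0 < d"
  shows "r powr d - 1 \<le> d * (r - 1) * r powr d"
proof -
  have "1 - r powr (- d) \<le> d * ln r"
    using exp_ge_add_one_self[of "- d * ln r"] assms by (simp add: powr_def)
  also have "\<dots> \<le> d * (r - 1)"
    using ln_le_minus_one[of r] assms by simp
  finally have "(1 - r powr (- d)) * r powr d \<le> d * (r - 1) * r powr d"
    by (rule mult_right_mono) simp
  then show ?thesis using assms by (simp add: left_diff_distrib powr_minus)
qed

lemma powr_diff_le:
  fixes r s d :: real
  assumes "0 < s" "s \<le> r" "0 < d"
  shows "s * (r powr d - s powr d) \<le> d * (r - s) * r powr d"
proof -
  have "((r / s) powr d - 1) * (s * s powr d) \<le> (d * (r / s - 1) * (r / s) powr d) * (s * s powr d)"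
    by (rule mult_right_mono[OF powr_minus_one_le]) (use assms in auto)
  then have "s * ((r / s) powr d * s powr d - s powr d)
      \<le> d * (r / s * s - s) * ((r / s) powr d * s powr d)"
    by (simp only: algebra_simps)
  moreover have "(r / s) powr d * s powr d = r powr d" "r / s * s = r"
    using assms by (simp_all flip: powr_mult)
  ultimately show ?thesis by simp
qed

text \<open>The gradient of \<open>\<bar>w\<bar>\<^sup>p\<close> is monotone, so the product \<open>X\<close> below has nonnegative real part; for
  complex arguments \<open>X\<close> need not be real, but it stays in a sector. With \<open>r = \<bar>a\<bar>\<close>, \<open>s = \<bar>b\<bar>\<close>,
  \<open>R = r\<^sup>p\<^sup>-\<^sup>1\<close>, \<open>S = s\<^sup>p\<^sup>-\<^sup>1\<close>, the real part splits into a radial term \<open>A = (R - S) (r - s)\<close> and an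
  angular term \<open>B\<close>, while the imaginary part is proportional to \<open>s R - r S\<close>. This difference is controlled
  by \<open>R - S\<close> and by \<open>r - s\<close>, so the square of the imaginary part is at most a multiple of
  \<open>A B\<close>, hence of \<open>(A + B)\<^sup>2\<close>.\<close>
lemma dual_power_sectorial:
  assumes p: "1 < p"
  shows "sector_slope p * \<bar>Im ((a - b) * cnj (dual_power p a - dual_power p b))\<bar>
    \<le> Re ((a - b) * cnj (dual_power p a - dual_power p b))"
    (is "_ * \<bar>Im (?X a b)\<bar> \<le> _")
proof -
  have slope: "0 < sector_slope p" by (rule sector_slope_pos[OF p])
  have main: "sector_slope p * \<bar>Im (?X a b)\<bar> \<le> Re (?X a b)"
    if "0 < cmod b" "cmod b \<le> cmod a" for a b
  proof -
    define r s R S where "r = cmod a" and "s = cmod b" and "R = r powr (p - 1)"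
      and "S = s powr (p - 1)"
    define c where "c = a * cnj b"
    define x y where "x = Re c" and "y = Im c"
    have rs: "0 < s" "s \<le> r" "0 < r" using that by (auto simp: r_def s_def)
    have RS: "0 < S" "S \<le> R" "0 < R"
      using rs p by (auto simp: R_def S_def intro!: powr_mono2)
    have R2: "r powr (p - 2) = R / r" "s powr (p - 2) = S / s"
      using rs powr_diff[of r "p - 1" 1] powr_diff[of s "p - 1" 1] by (auto simp: R_def S_def)
    have X: "?X a b = of_real (r * R) + of_real (s * S)
        - of_real (S / s) * c - of_real (R / r) * cnj c"
    proof -
      have "r powr p = r * R" "s powr p = s * S"
        using rs powr_add[of r 1 "p - 1"] powr_add[of s 1 "p - 1"] by (auto simp: R_def S_def)
      then have "cnj (dual_power p a) * a = of_real (r * R)" "cnj (dual_power p b) * b = of_real (s * S)"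
        using cnj_dual_power_mult_self[OF p] by (simp_all add: r_def s_def)
      moreover have "cnj (dual_power p a) * b = of_real (R / r) * cnj c"
        "cnj (dual_power p b) * a = of_real (S / s) * c"
        unfolding dual_power_def R2[symmetric] by (simp_all add: r_def s_def c_def)
      ultimately show ?thesis by (simp add: algebra_simps)
    qed
    have nc: "cmod c = r * s" by (simp add: c_def r_def s_def norm_mult)
    have xy: "x\<^sup>2 + y\<^sup>2 = (r * s)\<^sup>2"
      using cmod_power2[of c] by (simp add: x_def y_def nc)
    have "x \<le> r * s"
      using complex_Re_le_cmod[of c] by (simp add: x_def nc)
    moreover have "- x \<le> r * s"
      using abs_Re_le_cmod[of c] by (simp add: x_def nc)
    ultimately have x: "0 \<le> r * s - x" "r * s + x \<le> 2 * (r * s)" "0 \<le> r * s + x" by auto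
    define A B w where "A = (R - S) * (r - s)" and "B = (r * s - x) * (R / r + S / s)"
      and "w = \<bar>s * R - r * S\<bar>"
    have Re: "Re (?X a b) = A + B"
      unfolding X A_def B_def using rs by (simp add: x_def[symmetric] field_simps)
    have Im: "\<bar>Im (?X a b)\<bar> = \<bar>y\<bar> * (w / (r * s))"
    proof -
      have "Im (?X a b) = y * ((s * R - r * S) / (r * s))"
        unfolding X using rs by (simp add: y_def[symmetric] field_simps)
      then show ?thesis using rs by (simp add: w_def abs_mult)
    qed
    have AB: "0 \<le> A" "0 \<le> B" using x rs RS by (auto simp: A_def B_def)
    have k: "sector_slope p * (p - 1) \<le> 1" "sector_slope p \<le> p - 1"
      using p slope by (auto simp: sector_slope_def min_def field_simps)
    have k1: "sector_slope p \<le> 1"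
    proof (cases "p \<le> 2")
      case False
      then show ?thesis using p by (simp add: sector_slope_def min_def field_simps)
    qed (use k in auto)
    have k2: "sector_slope p * (sector_slope p * (p - 1)) \<le> 1" "sector_slope p * (sector_slope p / (p - 1)) \<le> 1"
    proof -
      show "sector_slope p * (sector_slope p * (p - 1)) \<le> 1"
        using mult_mono[OF k1 k(1)] slope p by simp
      have "sector_slope p / (p - 1) \<le> 1" using k(2) p by simp
      then show "sector_slope p * (sector_slope p / (p - 1)) \<le> 1"
        using mult_mono[OF k1, of "sector_slope p / (p - 1)" 1] slope p by simp
    qed
    have d1: "s * (R - S) \<le> (p - 1) * (r - s) * R"
      unfolding R_def S_def by (rule powr_diff_le) (use rs p in auto)
    have d2: "S * (r - s) \<le> 1 / (p - 1) * (R - S) * r"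
    proof -
      have "R powr (1 / (p - 1)) = r" "S powr (1 / (p - 1)) = s"
        using rs p by (auto simp: R_def S_def powr_powr)
      then show ?thesis using powr_diff_le[of S R "1 / (p - 1)"] RS p by simp
    qed
    have w2: "(sector_slope p * w)\<^sup>2 \<le> A * (s * R + r * S)"
    proof -
      \<comment> \<open>A difference of two nonnegative numbers is bounded by the larger one.\<close>
      have e: "s * R - r * S = s * (R - S) - S * (r - s)" by (simp add: algebra_simps)
      have n: "0 \<le> s * (R - S)" "0 \<le> S * (r - s)" using rs RS by auto
      have "w \<le> s * (R - S) \<or> w \<le> S * (r - s)" unfolding w_def e using n by linarith
      then show ?thesis
      proof
        assume "w \<le> s * (R - S)"
        then have "w\<^sup>2 \<le> (s * (R - S)) * (s * (R - S))"
          using n mult_mono[of w "s * (R - S)" w "s * (R - S)"] by (simp add: w_def power2_eq_square)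
        also have "\<dots> \<le> (s * (R - S)) * ((p - 1) * (r - s) * R)"
          by (rule mult_left_mono[OF d1 n(1)])
        finally have "(sector_slope p * w)\<^sup>2 \<le> (sector_slope p)\<^sup>2 * ((s * (R - S)) * ((p - 1) * (r - s) * R))"
          unfolding power_mult_distrib by (rule mult_left_mono) simp
        also have "\<dots> = (sector_slope p * (sector_slope p * (p - 1))) * (A * (s * R))"
          by (simp add: A_def power2_eq_square algebra_simps)
        also have "\<dots> \<le> 1 * (A * (s * R))"
          by (rule mult_right_mono[OF k2(1)]) (use AB rs RS in auto)
        also have "\<dots> \<le> A * (s * R + r * S)" using AB rs RS by (simp add: algebra_simps)
        finally show ?thesis .
      next
        assume "w \<le> S * (r - s)"
        then have "w\<^sup>2 \<le> (S * (r - s)) * (S * (r - s))"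
          using n mult_mono[of w "S * (r - s)" w "S * (r - s)"] by (simp add: w_def power2_eq_square)
        also have "\<dots> \<le> (S * (r - s)) * (1 / (p - 1) * (R - S) * r)"
          by (rule mult_left_mono[OF d2 n(2)])
        finally have "(sector_slope p * w)\<^sup>2 \<le> (sector_slope p)\<^sup>2 * ((S * (r - s)) * (1 / (p - 1) * (R - S) * r))"
          unfolding power_mult_distrib by (rule mult_left_mono) simp
        also have "\<dots> = (sector_slope p * (sector_slope p / (p - 1))) * (A * (r * S))"
          by (simp add: A_def power2_eq_square divide_inverse algebra_simps)
        also have "\<dots> \<le> 1 * (A * (r * S))"
          by (rule mult_right_mono[OF k2(2)]) (use AB rs RS in auto)
        also have "\<dots> \<le> A * (s * R + r * S)" using AB rs RS by (simp add: algebra_simps)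
        finally show ?thesis .
      qed
    qed
    have y2: "y\<^sup>2 \<le> 2 * (r * s) * (r * s - x)"
    proof -
      have "y\<^sup>2 = (r * s + x) * (r * s - x)" using xy by (simp add: power2_eq_square algebra_simps)
      also have "\<dots> \<le> 2 * (r * s) * (r * s - x)" by (rule mult_right_mono) (use x in auto)
      finally show ?thesis .
    qed
    have "(sector_slope p * (\<bar>y\<bar> * (w / (r * s))))\<^sup>2 = y\<^sup>2 * (sector_slope p * w)\<^sup>2 / (r * s)\<^sup>2"
      by (simp add: power_mult_distrib power_divide)
    also have "\<dots> \<le> (2 * (r * s) * (r * s - x)) * (A * (s * R + r * S)) / (r * s)\<^sup>2"
      by (intro divide_right_mono mult_mono y2 w2) (use x rs in auto)
    also have "\<dots> = 2 * (A * B)"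
      unfolding B_def using rs by (simp add: field_simps power2_eq_square)
    also have "\<dots> \<le> (A + B)\<^sup>2"
      using AB by (simp add: power2_sum)
    finally have "sector_slope p * (\<bar>y\<bar> * (w / (r * s))) \<le> A + B"
      by (rule power2_le_imp_le) (use AB in auto)
    then show ?thesis unfolding Re Im .
  qed
  have sym: "?X b a = ?X a b" by (simp add: algebra_simps)
  have zero: "?X a 0 = of_real (cmod a powr p)" for a
    using cnj_dual_power_mult_self[OF p, of a] by (simp add: dual_power_def mult.commute)
  consider "a = 0" | "b = 0" | "0 < cmod b" "cmod b \<le> cmod a" | "0 < cmod a" "cmod a \<le> cmod b"
    by fastforce
  then show ?thesis
  proof cases
    case 1
    have "?X 0 b = of_real (cmod b powr p)"
      using zero[of b] by (simp add: algebra_simps)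
    then show ?thesis unfolding 1 by simp
  next
    case 2
    then show ?thesis using zero[of a] by simp
  next
    case 3
    then show ?thesis by (rule main)
  next
    case 4
    then show ?thesis using main[of a b] sym by metis
  qed
qed

text \<open>The matrix with rows \<open>(1 - \<eta>, \<eta>)\<close> and \<open>(\<eta>, 1 - \<eta>)\<close> is an implicit Euler step, with complex step
  \<open>z\<close>, for the averaging generator on two points: \<open>1 - 2 \<eta> = 1 / (1 + z)\<close>. For an implicit step the
  subgradient inequality is applied at the new point \<open>(v, w)\<close>, and the loss in the sum of
  \<open>p\<close>-th powers is then at least a multiple of \<open>Re (z X)\<close> with the sectorial quantity \<open>X\<close> of the previous lemma; it is
  nonnegative when \<open>z\<close> lies in the sector. No estimate of higher order terms enters, so the matrix is
  an exact contraction and its powers can be taken freely.\<close>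
lemma two_point_contraction:
  assumes p: "1 < p" and z: "0 \<le> Re z" "\<bar>Im z\<bar> \<le> sector_slope p * Re z"
    and eta: "\<eta> = z / (2 * (1 + z))"
  shows "cmod ((1 - \<eta>) * a + \<eta> * b) powr p + cmod ((1 - \<eta>) * b + \<eta> * a) powr p
    \<le> cmod a powr p + cmod b powr p"
proof -
  have "1 + z \<noteq> 0" using z(1) by (auto simp: complex_eq_iff)
  define v w where "v = (1 - \<eta>) * a + \<eta> * b" and "w = (1 - \<eta>) * b + \<eta> * a"
  define X where "X = (v - w) * cnj (dual_power p v - dual_power p w)"
  have n0: "2 + 2 * z \<noteq> 0" using \<open>1 + z \<noteq> 0\<close> 
    by (metis distrib_left_numeral mult.right_neutral mult_eq_0_iff zero_neq_numeral)
  have vw: "v - w = (a - b) / (1 + z)"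
  proof -
    have "v - w = (1 - 2 * \<eta>) * (a - b)" by (simp add: v_def w_def algebra_simps)
    also have "1 - 2 * \<eta> = 1 / (1 + z)" unfolding eta using \<open>1 + z \<noteq> 0\<close> n0 by (simp add: field_simps)
    finally show ?thesis by simp
  qed
  have av: "a - v = z / 2 * (v - w)" "b - w = - (z / 2 * (v - w))"
  proof -
    have "a - v = \<eta> * (a - b)" "b - w = - (\<eta> * (a - b))" by (simp_all add: v_def w_def algebra_simps)
    moreover have "\<eta> * (a - b) = z / 2 * (v - w)" unfolding vw eta by simp
    ultimately show "a - v = z / 2 * (v - w)" "b - w = - (z / 2 * (v - w))" by simp_all
  qed
  define \<alpha> \<beta> where "\<alpha> = Re (cnj (dual_power p v) * (z / 2 * (v - w)))"
    and "\<beta> = Re (cnj (dual_power p w) * - (z / 2 * (v - w)))"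
  have "cmod v powr p + p * \<alpha> \<le> cmod a powr p" "cmod w powr p + p * \<beta> \<le> cmod b powr p"
    unfolding \<alpha>_def \<beta>_def
    using cmod_powr_subgradient[OF p, of v a] cmod_powr_subgradient[OF p, of w b] unfolding av by auto
  moreover have "\<alpha> + \<beta> = Re (z * X) / 2"
  proof -
    have "cnj (dual_power p v) * (z / 2 * (v - w)) + cnj (dual_power p w) * - (z / 2 * (v - w)) = z * X / 2"
    proof -
      have "cnj F * (z / 2 * D) + cnj G * - (z / 2 * D) = z * (D * cnj (F - G)) / 2" for F G D
        by (simp add: algebra_simps diff_divide_distrib)
      then show ?thesis unfolding X_def .
    qed
    then show ?thesis unfolding \<alpha>_def \<beta>_def by (metis Re_divide_numeral plus_complex.sel(1))
  qed
  moreover have "0 \<le> Re (z * X)"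
  proof -
    have X: "sector_slope p * \<bar>Im X\<bar> \<le> Re X" unfolding X_def by (rule dual_power_sectorial[OF p])
    have "Im z * Im X \<le> \<bar>Im z\<bar> * \<bar>Im X\<bar>" by (metis abs_ge_self abs_mult)
    also have "\<dots> \<le> (sector_slope p * Re z) * \<bar>Im X\<bar>" by (rule mult_right_mono[OF z(2)]) simp
    also have "\<dots> = Re z * (sector_slope p * \<bar>Im X\<bar>)" by simp
    also have "\<dots> \<le> Re z * Re X" by (rule mult_left_mono[OF X z(1)])
    finally show ?thesis by simp
  qed
  moreover from calculation have "0 \<le> p * \<alpha> + p * \<beta>"
    using p unfolding distrib_left[symmetric] by simp
  ultimately have "cmod v powr p + cmod w powr p \<le> cmod a powr p + cmod b powr p"
    by linarith
  then show ?thesis unfolding v_def w_def .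
qed

section \<open>Functions in \<open>L\<^sup>p\<close>\<close>
lemma jensen_cmod_powr:
  assumes p: "1 < p" and S: "finite S" "(\<Sum>i\<in>S. a i) = 1" "\<And>i. i \<in> S \<Longrightarrow> 0 \<le> a i"
  shows "cmod (\<Sum>i\<in>S. of_real (a i) * w i) powr p \<le> (\<Sum>i\<in>S. a i * cmod (w i) powr p)"
proof -
  define v where "v = (\<Sum>i\<in>S. of_real (a i) * w i)"
  define l where "l = (\<lambda>i. Re (cnj (dual_power p v) * (w i - v)))"
  have "(\<Sum>i\<in>S. of_real (a i) * (F * (w i - v')))
      = F * ((\<Sum>i\<in>S. of_real (a i) * w i) - (\<Sum>i\<in>S. of_real (a i)) * v')" for F v'
    by (simp add: sum_distrib_left sum_distrib_right sum_subtractf algebra_simps)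
  then have "(\<Sum>i\<in>S. of_real (a i) * (cnj (dual_power p v) * (w i - v)))
      = cnj (dual_power p v) * (v - (\<Sum>i\<in>S. of_real (a i)) * v)"
    unfolding v_def .
  also have "(\<Sum>i\<in>S. of_real (a i)) = (1 :: complex)" using S(2) by (metis of_real_1 of_real_sum)
  finally have 0: "(\<Sum>i\<in>S. of_real (a i) * (cnj (dual_power p v) * (w i - v))) = 0" by simp
  have "(\<Sum>i\<in>S. a i * l i) = Re (\<Sum>i\<in>S. of_real (a i) * (cnj (dual_power p v) * (w i - v)))"
    unfolding l_def Re_sum by (simp only: Re_complex_of_real Im_complex_of_real times_complex.sel) simp
  then have l0: "(\<Sum>i\<in>S. a i * l i) = 0" unfolding 0 by simp
  have "cmod v powr p = (\<Sum>i\<in>S. a i * (cmod v powr p + p * l i))"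
  proof -
    have "(\<Sum>i\<in>S. a i * (cmod v powr p + p * l i))
        = (\<Sum>i\<in>S. a i) * cmod v powr p + p * (\<Sum>i\<in>S. a i * l i)"
      by (simp add: sum_distrib_left sum_distrib_right sum.distrib algebra_simps)
    then show ?thesis using l0 S(2) by simp
  qed
  also have "\<dots> \<le> (\<Sum>i\<in>S. a i * cmod (w i) powr p)"
    by (intro sum_mono mult_left_mono S(3)) (use cmod_powr_subgradient[OF p] in \<open>auto simp: l_def\<close>)
  finally show ?thesis unfolding v_def .
qed

text \<open>The bookkeeping behind \<open>two_point_step_simple\<close>. There \<open>t c d\<close> is the mass moved from the
  level set of \<open>d\<close> to that of \<open>c\<close>, and \<open>0\<close> stands for the region where the function vanishes,
  which may have infinite measure and is therefore kept out of \<open>C\<close>. By symmetry of \<open>t\<close> the values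
  \<open>G c d\<close> and \<open>G d c\<close> come with the same weight, so the two-point bound applies to each pair.
  The remaining mass of \<open>c\<close> is paired with \<open>0\<close>.\<close>
lemma symmetric_weights_sum_le:
  fixes t G :: "'c::zero \<Rightarrow> 'c \<Rightarrow> real"
  assumes "finite C"
    and t: "\<And>c d. c \<in> C \<Longrightarrow> d \<in> C \<Longrightarrow> 0 \<le> t c d" "\<And>c d. c \<in> C \<Longrightarrow> d \<in> C \<Longrightarrow> t c d = t d c"
    and I: "\<And>c. c \<in> C \<Longrightarrow> (\<Sum>d\<in>C. t c d) \<le> I c" "\<And>c. c \<in> C \<Longrightarrow> I c \<le> \<mu> c"
    and G: "\<And>c d. 0 \<le> G c d" "\<And>c d. G c d + G d c \<le> K c + K d" "K 0 = 0"
  shows "(\<Sum>c\<in>C. (\<Sum>d\<in>C. t c d * G d c) + (I c - (\<Sum>d\<in>C. t c d)) * G 0 c)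
      + (\<Sum>d\<in>C. (\<mu> d - (\<Sum>c\<in>C. t c d)) * G d 0) \<le> (\<Sum>c\<in>C. \<mu> c * K c)"
proof -
  define s where "s = (\<lambda>c. \<Sum>d\<in>C. t c d)"
  have s: "(\<Sum>c\<in>C. t c d) = s d" if "d \<in> C" for d
    unfolding s_def using t(2) that by (intro sum.cong) auto
  have swap: "(\<Sum>c\<in>C. \<Sum>d\<in>C. t c d * H d c) = (\<Sum>c\<in>C. \<Sum>d\<in>C. t c d * H c d)" for H
    by (subst sum.swap) (intro sum.cong refl, use t(2) in auto)
  have "(\<Sum>c\<in>C. \<Sum>d\<in>C. t c d * G d c) + (\<Sum>c\<in>C. \<Sum>d\<in>C. t c d * G d c)
      = (\<Sum>c\<in>C. \<Sum>d\<in>C. t c d * (G c d + G d c))"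
    by (subst swap) (simp add: sum.distrib distrib_left)
  also have "\<dots> \<le> (\<Sum>c\<in>C. \<Sum>d\<in>C. t c d * (K c + K d))"
    by (intro sum_mono mult_left_mono t G)
  also have "\<dots> = (\<Sum>c\<in>C. \<Sum>d\<in>C. t c d * K c) + (\<Sum>c\<in>C. \<Sum>d\<in>C. t c d * K c)"
    using swap[of "\<lambda>c d. K c"] by (simp add: sum.distrib distrib_left)
  also have "(\<Sum>c\<in>C. \<Sum>d\<in>C. t c d * K c) = (\<Sum>c\<in>C. s c * K c)"
    by (simp add: s_def sum_distrib_right)
  finally have 1: "(\<Sum>c\<in>C. \<Sum>d\<in>C. t c d * G d c) \<le> (\<Sum>c\<in>C. s c * K c)" by simp
  have "(\<Sum>c\<in>C. (I c - s c) * G 0 c) + (\<Sum>c\<in>C. (\<mu> c - s c) * G c 0)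
      \<le> (\<Sum>c\<in>C. (\<mu> c - s c) * K c)"
    unfolding sum.distrib[symmetric]
  proof (rule sum_mono)
    fix c assume c: "c \<in> C"
    have "(I c - s c) * G 0 c + (\<mu> c - s c) * G c 0 \<le> (\<mu> c - s c) * (G 0 c + G c 0)"
      using mult_right_mono[of "I c - s c" "\<mu> c - s c" "G 0 c"] I(2)[OF c] G(1)
      by (simp add: distrib_left)
    also have "\<dots> \<le> (\<mu> c - s c) * K c"
      using G(2)[of 0 c] G(3) I[OF c] by (intro mult_left_mono) (auto simp: s_def)
    finally show "(I c - s c) * G 0 c + (\<mu> c - s c) * G c 0 \<le> (\<mu> c - s c) * K c" .
  qed
  moreover have "(\<Sum>d\<in>C. (\<mu> d - (\<Sum>c\<in>C. t c d)) * G d 0) = (\<Sum>c\<in>C. (\<mu> c - s c) * G c 0)"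
    by (intro sum.cong refl) (simp add: s)
  moreover have "sum (t c) C = s c" for c by (simp add: s_def)
  moreover have "(\<Sum>c\<in>C. (\<mu> c - s c) * K c) = (\<Sum>c\<in>C. \<mu> c * K c) - (\<Sum>c\<in>C. s c * K c)"
    by (simp add: left_diff_distrib sum_subtractf)
  ultimately show ?thesis
    using 1 by (simp add: sum.distrib)
qed

lemma abs_add_powr_le:
  fixes a b p :: real
  assumes "0 \<le> p"
  shows "\<bar>a + b\<bar> powr p \<le> 2 powr p * (\<bar>a\<bar> powr p + \<bar>b\<bar> powr p)"
proof -
  have "\<bar>a + b\<bar> powr p \<le> (2 * max \<bar>a\<bar> \<bar>b\<bar>) powr p"
    by (rule powr_mono2) (use assms in auto)
  also have "\<dots> = 2 powr p * max \<bar>a\<bar> \<bar>b\<bar> powr p" by (simp add: powr_mult)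
  also have "\<dots> \<le> 2 powr p * (\<bar>a\<bar> powr p + \<bar>b\<bar> powr p)"
    by (intro mult_left_mono) (auto simp: max_def)
  finally show ?thesis .
qed

lemma LpD:
  assumes "f \<in> Lp m p"
  shows "f \<in> borel_measurable m" "integrable m (\<lambda>x. \<bar>f x\<bar> powr p)"
  using assms by (auto simp: Lp_def)

lemma Lp_lincomb:
  assumes "0 \<le> p" "f \<in> Lp m p" "g \<in> Lp m p"
  shows "(\<lambda>x. a * f x + b * g x) \<in> Lp m p"
proof -
  note [measurable] = LpD(1)[OF assms(2)] LpD(1)[OF assms(3)]
  have "integrable m (\<lambda>x. 2 powr p * (\<bar>a\<bar> powr p * \<bar>f x\<bar> powr p + \<bar>b\<bar> powr p * \<bar>g x\<bar> powr p))"
    using LpD(2)[OF assms(2)] LpD(2)[OF assms(3)] by auto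
  moreover have le: "\<bar>a * f x + b * g x\<bar> powr p
      \<le> 2 powr p * (\<bar>a\<bar> powr p * \<bar>f x\<bar> powr p + \<bar>b\<bar> powr p * \<bar>g x\<bar> powr p)" for x
    using abs_add_powr_le[OF assms(1), of "a * f x" "b * g x"] by (simp add: abs_mult powr_mult)
  from calculation(1) have "integrable m (\<lambda>x. \<bar>a * f x + b * g x\<bar> powr p)"
    by (rule Bochner_Integration.integrable_bound[OF _ _ AE_I2])
      (measurable, metis le abs_of_nonneg order_trans powr_ge_zero real_norm_def abs_ge_self)
  then show ?thesis by (auto simp: Lp_def)
qed

lemma Lp_diff:
  assumes "0 \<le> p" "f \<in> Lp m p" "g \<in> Lp m p"
  shows "(\<lambda>x. f x - g x) \<in> Lp m p"
  using Lp_lincomb[OF assms, of 1 "-1"] by simp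

lemma Lp_zero: "(\<lambda>_. 0) \<in> Lp m p" by (simp add: Lp_def)

lemma Lp_indicator:
  assumes "A \<in> sets m" "emeasure m A < \<infinity>"
  shows "indicator A \<in> Lp m p"
proof -
  have "(\<lambda>x. \<bar>indicator A x :: real\<bar> powr p) = indicator A" by (auto simp: indicator_def)
  then show ?thesis using assms by (simp add: Lp_def)
qed

lemma Lp_norm_le_iff:
  assumes "0 < p"
  shows "Lp_norm m p f \<le> Lp_norm m p g \<longleftrightarrow> (\<integral>x. \<bar>f x\<bar> powr p \<partial>m) \<le> (\<integral>x. \<bar>g x\<bar> powr p \<partial>m)"
proof -
  have "a powr (1 / p) \<le> b powr (1 / p) \<longleftrightarrow> a \<le> b" if "0 \<le> a" "0 \<le> b" for a b :: real
    using powr_less_mono2[of "1 / p" b a] powr_mono2[of "1 / p" a b] assms that by force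
  then show ?thesis unfolding Lp_norm_def by (simp add: integral_nonneg_AE)
qed

lemma Lp_norm_tendsto_0_iff:
  assumes "0 < p"
  shows "((\<lambda>i. Lp_norm m p (f i)) \<longlongrightarrow> 0) F \<longleftrightarrow> ((\<lambda>i. \<integral>x. \<bar>f i x\<bar> powr p \<partial>m) \<longlongrightarrow> 0) F"
proof
  assume *: "((\<lambda>i. Lp_norm m p (f i)) \<longlongrightarrow> 0) F"
  have "((\<lambda>i. Lp_norm m p (f i) powr p) \<longlongrightarrow> 0 powr p) F"
    by (rule tendsto_powr'[OF * tendsto_const]) (use assms in \<open>auto simp: Lp_norm_def\<close>)
  then show "((\<lambda>i. \<integral>x. \<bar>f i x\<bar> powr p \<partial>m) \<longlongrightarrow> 0) F"
    using assms by (simp add: Lp_norm_def powr_powr integral_nonneg_AE)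
next
  assume *: "((\<lambda>i. \<integral>x. \<bar>f i x\<bar> powr p \<partial>m) \<longlongrightarrow> 0) F"
  have "((\<lambda>i. (\<integral>x. \<bar>f i x\<bar> powr p \<partial>m) powr (1 / p)) \<longlongrightarrow> 0 powr (1 / p)) F"
    by (rule tendsto_powr'[OF * tendsto_const]) (use assms in \<open>auto simp: integral_nonneg_AE\<close>)
  then show "((\<lambda>i. Lp_norm m p (f i)) \<longlongrightarrow> 0) F" by (simp add: Lp_norm_def)
qed

lemma abs_mult_le_young:
  fixes u v p :: real
  assumes "1 < p"
  shows "\<bar>u * v\<bar> \<le> \<bar>u\<bar> powr p / p + (1 - 1 / p) * \<bar>v\<bar> powr (p / (p - 1))"
  using young_dual[of p "\<bar>u\<bar>" "\<bar>v\<bar> powr (1 / (p - 1))"] assms by (simp add: abs_mult powr_powr)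

lemma integrable_Lp_mult:
  assumes p: "1 < p" and u: "u \<in> Lp m p" and v: "v \<in> Lp m (p / (p - 1))"
  shows "integrable m (\<lambda>x. u x * v x)"
proof -
  note [measurable] = LpD(1)[OF u] LpD(1)[OF v]
  show ?thesis
    by (rule Bochner_Integration.integrable_bound[where
        f="\<lambda>x. \<bar>u x\<bar> powr p / p + (1 - 1 / p) * \<bar>v x\<bar> powr (p / (p - 1))"])
      (use abs_mult_le_young[OF p] LpD(2)[OF u] LpD(2)[OF v] in \<open>auto intro: order_trans[OF _ abs_ge_self]\<close>)
qed

lemma signed_powr_Lp:
  assumes p: "1 < p" and f: "f \<in> Lp m p"
  shows "(\<lambda>x. signed_powr (f x) (p - 1)) \<in> Lp m (p / (p - 1))"
    and "\<bar>signed_powr a (p - 1)\<bar> powr (p / (p - 1)) = \<bar>a\<bar> powr p"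
proof -
  note [measurable] = LpD(1)[OF f]
  show *: "\<bar>signed_powr a (p - 1)\<bar> powr (p / (p - 1)) = \<bar>a\<bar> powr p" for a
    using p by (cases "a = 0") (auto simp: signed_powr_def abs_mult powr_powr)
  have "(\<lambda>x. signed_powr (f x) (p - 1)) \<in> borel_measurable m"
    unfolding signed_powr_def by measurable
  then show "(\<lambda>x. signed_powr (f x) (p - 1)) \<in> Lp m (p / (p - 1))"
    using LpD(2)[OF f] by (simp add: Lp_def *)
qed

lemma abs_powr_subgradient:
  fixes a b p :: real
  assumes "1 < p"
  shows "\<bar>b\<bar> powr p + p * (signed_powr b (p - 1) * (a - b)) \<le> \<bar>a\<bar> powr p"
proof -
  have "signed_powr b (p - 1) = Re (cnj (dual_power p (of_real b)))"
  proof (cases "b = 0")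
    case False
    then have "\<bar>b\<bar> powr (p - 1) = \<bar>b\<bar> powr (p - 2) * \<bar>b\<bar> powr 1"
      unfolding powr_add[symmetric] by simp
    then show ?thesis using False
      by (simp add: signed_powr_def dual_power_def sgn_real_def)
  qed (simp add: signed_powr_def dual_power_def)
  moreover have "Im (cnj (dual_power p (of_real b))) = 0" by (simp add: dual_power_def)
  ultimately show ?thesis
    using cmod_powr_subgradient[OF assms, of "of_real b" "of_real a"]
    by simp
qed

text \<open>The operators act on real functions while the contraction estimates concern complex ones; this
  lemma passes between the two.\<close>
lemma complex_Lp_iff:
  fixes u :: "'a \<Rightarrow> complex"
  assumes "0 < p"
  shows "u \<in> borel_measurable m \<and> integrable m (\<lambda>x. cmod (u x) powr p) \<longleftrightarrow>
    (\<lambda>x. Re (u x)) \<in> Lp m p \<and> (\<lambda>x. Im (u x)) \<in> Lp m p"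
proof safe
  assume [measurable]: "u \<in> borel_measurable m" and int: "integrable m (\<lambda>x. cmod (u x) powr p)"
  have "\<bar>Re z\<bar> powr p \<le> cmod z powr p" "\<bar>Im z\<bar> powr p \<le> cmod z powr p" for z
    using assms by (auto intro!: powr_mono2 abs_Re_le_cmod abs_Im_le_cmod)
  then have "integrable m (\<lambda>x. \<bar>Re (u x)\<bar> powr p)" "integrable m (\<lambda>x. \<bar>Im (u x)\<bar> powr p)"
    by (auto intro!: Bochner_Integration.integrable_bound[OF int])
  then show "(\<lambda>x. Re (u x)) \<in> Lp m p" "(\<lambda>x. Im (u x)) \<in> Lp m p" by (auto simp: Lp_def)
next
  assume *: "(\<lambda>x. Re (u x)) \<in> Lp m p" "(\<lambda>x. Im (u x)) \<in> Lp m p"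
  note [measurable] = *[THEN LpD(1)]
  have "(\<lambda>x. Complex (Re (u x)) (Im (u x))) \<in> borel_measurable m"
    unfolding Complex_eq by measurable
  then show [measurable]: "u \<in> borel_measurable m" by simp
  have int: "integrable m (\<lambda>x. 2 powr p * (\<bar>Re (u x)\<bar> powr p + \<bar>Im (u x)\<bar> powr p))"
    using *[THEN LpD(2)] by auto
  have le: "cmod z powr p \<le> 2 powr p * (\<bar>Re z\<bar> powr p + \<bar>Im z\<bar> powr p)" for z
  proof -
    have "cmod z powr p \<le> \<bar>\<bar>Re z\<bar> + \<bar>Im z\<bar>\<bar> powr p"
      using assms cmod_le[of z] by (intro powr_mono2) auto
    then show ?thesis using abs_add_powr_le[of p "\<bar>Re z\<bar>" "\<bar>Im z\<bar>"] assms by simp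
  qed
  show "integrable m (\<lambda>x. cmod (u x) powr p)"
    by (rule Bochner_Integration.integrable_bound[OF int]) (auto intro!: AE_I2 order_trans[OF le])
qed

section \<open>Symmetric sub-Markovian operators satisfy the two-point bound\<close>
definition complexify :: "(('a \<Rightarrow> real) \<Rightarrow> 'a \<Rightarrow> real) \<Rightarrow> ('a \<Rightarrow> complex) \<Rightarrow> 'a \<Rightarrow> complex" where
  "complexify T u = (\<lambda>x. Complex (T (\<lambda>y. Re (u y)) x) (T (\<lambda>y. Im (u y)) x))"

locale Lp_contraction =
  fixes m :: "'a measure" and p :: real and T :: "('a \<Rightarrow> real) \<Rightarrow> 'a \<Rightarrow> real"
  assumes p: "1 < p"
    and maps_Lp: "f \<in> Lp m p \<Longrightarrow> T f \<in> Lp m p"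
    and linear: "f \<in> Lp m p \<Longrightarrow> g \<in> Lp m p \<Longrightarrow>
      AE x in m. T (\<lambda>y. a * f y + b * g y) x = a * T f x + b * T g x"
    and contraction: "f \<in> Lp m p \<Longrightarrow> (\<integral>x. \<bar>T f x\<bar> powr p \<partial>m) \<le> (\<integral>x. \<bar>f x\<bar> powr p \<partial>m)"
begin

lemma contraction_diff:
  assumes "f \<in> Lp m p" "g \<in> Lp m p"
  shows "(\<integral>x. \<bar>T f x - T g x\<bar> powr p \<partial>m) \<le> (\<integral>x. \<bar>f x - g x\<bar> powr p \<partial>m)"
proof -
  have "(\<lambda>y. f y - g y) \<in> Lp m p" by (rule Lp_diff) (use p assms in auto)
  note [measurable] = assms[THEN maps_Lp, THEN LpD(1)] LpD(1)[OF maps_Lp[OF this]]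
  have "(\<integral>x. \<bar>T f x - T g x\<bar> powr p \<partial>m) = (\<integral>x. \<bar>T (\<lambda>y. 1 * f y + (-1) * g y) x\<bar> powr p \<partial>m)"
    using linear[OF assms, of 1 "-1"] p assms
    by (intro integral_cong_AE) auto
  also have "\<dots> \<le> (\<integral>x. \<bar>1 * f x + (-1) * g x\<bar> powr p \<partial>m)"
    by (rule contraction[OF Lp_lincomb]) (use p assms in auto)
  finally show ?thesis by simp
qed

lemma cong_AE:
  assumes "f \<in> Lp m p" "g \<in> Lp m p" "AE x in m. f x = g x"
  shows "AE x in m. T f x = T g x"
proof -
  note [measurable] = assms(1,2)[THEN LpD(1)]
  have "(\<integral>x. \<bar>f x - g x\<bar> powr p \<partial>m) = (\<integral>x. 0 \<partial>m)"
    using assms by (intro integral_cong_AE) auto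
  then have "(\<integral>x. \<bar>T f x - T g x\<bar> powr p \<partial>m) = 0"
    using contraction_diff[OF assms(1,2)] by (intro antisym integral_nonneg_AE) auto
  moreover have "integrable m (\<lambda>x. \<bar>T f x - T g x\<bar> powr p)"
    by (rule LpD(2)[OF Lp_diff]) (use p maps_Lp assms in auto)
  ultimately show ?thesis by (subst (asm) integral_nonneg_eq_0_iff_AE) auto
qed

lemma linear_sum:
  assumes "finite C" "\<And>c. c \<in> C \<Longrightarrow> f c \<in> Lp m p"
  shows "(\<lambda>y. \<Sum>c\<in>C. k c * f c y) \<in> Lp m p \<and>
    (AE x in m. T (\<lambda>y. \<Sum>c\<in>C. k c * f c y) x = (\<Sum>c\<in>C. k c * T (f c) x))"
  using assms
proof (induction C rule: finite_induct)
  case empty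
  show ?case using linear[OF Lp_zero Lp_zero, of 0 0] by (simp add: Lp_zero)
next
  case (insert d C)
  let ?g = "\<lambda>y. \<Sum>c\<in>C. k c * f c y"
  have IH: "?g \<in> Lp m p" "AE x in m. T ?g x = (\<Sum>c\<in>C. k c * T (f c) x)"
    using insert.IH insert.prems by auto
  have d: "f d \<in> Lp m p" using insert.prems by simp
  have eq: "(\<lambda>y. \<Sum>c\<in>insert d C. k c * f c y) = (\<lambda>y. k d * f d y + 1 * ?g y)"
    using insert.hyps by simp
  have "AE x in m. T (\<lambda>y. k d * f d y + 1 * ?g y) x = (\<Sum>c\<in>insert d C. k c * T (f c) x)"
    using linear[OF d IH(1), of "k d" 1] IH(2) by eventually_elim (use insert.hyps in simp)
  moreover have "(\<lambda>y. k d * f d y + 1 * ?g y) \<in> Lp m p"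
    by (rule Lp_lincomb) (use d IH p in auto)
  ultimately show ?case unfolding eq by blast
qed

end

text \<open>Indicators of sets of finite measure suffice to describe positivity, the sub-Markov property,
  the contraction property on \<open>L\<^sup>1\<close> and symmetry, because the operator is only taken apart on
  simple functions.\<close>
locale symmetric_submarkov = Lp_contraction +
  assumes indicator_bounds: "A \<in> sets m \<Longrightarrow> emeasure m A < \<infinity> \<Longrightarrow>
      AE x in m. 0 \<le> T (indicator A) x \<and> T (indicator A) x \<le> 1"
    and indicator_integrable: "A \<in> sets m \<Longrightarrow> emeasure m A < \<infinity> \<Longrightarrow> integrable m (T (indicator A))"
    and indicator_integral: "A \<in> sets m \<Longrightarrow> emeasure m A < \<infinity> \<Longrightarrow>
      (\<integral>x. T (indicator A) x \<partial>m) \<le> measure m A"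
    and indicator_symmetric: "A \<in> sets m \<Longrightarrow> emeasure m A < \<infinity> \<Longrightarrow> B \<in> sets m \<Longrightarrow> emeasure m B < \<infinity> \<Longrightarrow>
      (\<integral>x. T (indicator A) x * indicator B x \<partial>m) = (\<integral>x. T (indicator B) x * indicator A x \<partial>m)"
begin

text \<open>On a simple function the operator acts like a symmetric matrix: if \<open>\<tau> c\<close> is the image of the
  indicator of the level set \<open>A c\<close>, then at almost every point the value of the new function is
  an average of the numbers \<open>(1 - \<eta>) u x + \<eta> c\<close> with weights \<open>\<tau> c x\<close>, the missing weight going to
  \<open>c = 0\<close>. Jensen's inequality and integration over the level sets leave a double sum with the
  symmetric weights \<open>t c d\<close>.\<close>
lemma two_point_step_simple:
  fixes u :: "'a \<Rightarrow> complex"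
  assumes u: "simple_function m u" "emeasure m {x\<in>space m. u x \<noteq> 0} < \<infinity>"
    and two_point: "\<And>a b. cmod ((1 - \<eta>) * a + \<eta> * b) powr p + cmod ((1 - \<eta>) * b + \<eta> * a) powr p
      \<le> cmod a powr p + cmod b powr p"
  shows "(\<integral>x. cmod ((1 - \<eta>) * u x + \<eta> * complexify T u x) powr p \<partial>m) \<le> (\<integral>x. cmod (u x) powr p \<partial>m)"
proof -
  define C where "C = u ` space m - {0}"
  define A where "A = (\<lambda>c. u -` {c} \<inter> space m)"
  define \<tau> where "\<tau> = (\<lambda>c. T (indicator (A c)))"
  have C: "finite C" "0 \<notin> C" using u(1) by (auto simp: C_def simple_function_def)
  have A_meas[measurable]: "A c \<in> sets m" for c
    unfolding A_def using u(1) by (cases "c \<in> u ` space m")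
      (auto simp: simple_function_def intro: back_subst[of "\<lambda>S. S \<in> sets m", OF sets.empty_sets])
  have [measurable]: "u \<in> borel_measurable m" by (rule borel_measurable_simple_function[OF u(1)])
  have A_fin: "emeasure m (A c) < \<infinity>" if "c \<in> C" for c
  proof -
    have "emeasure m (A c) \<le> emeasure m {x\<in>space m. u x \<noteq> 0}"
      by (rule emeasure_mono) (use that C(2) in \<open>auto simp: A_def\<close>)
    then show ?thesis using u(2) by (rule le_less_trans)
  qed
  have ind_Lp: "indicator (A c) \<in> Lp m p" if "c \<in> C" for c
    by (rule Lp_indicator) (use A_fin[OF that] in auto)
  \<comment> \<open>At each point at most one level set contributes.\<close>
  have expand: "(\<Sum>d\<in>C. indicator (A d) x * F d) = (if u x = 0 then 0 else F (u x))"
    if "x \<in> space m" for x and F :: "complex \<Rightarrow> real"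
  proof -
    have "(\<Sum>d\<in>C. indicator (A d) x * F d) = (\<Sum>d\<in>C. if d = u x then F d else 0)"
      using that by (intro sum.cong refl) (auto simp: A_def indicator_def)
    also have "\<dots> = (if u x = 0 then 0 else F (u x))"
      using C that by (auto simp: C_def sum.delta)
    finally show ?thesis .
  qed
  have u_Lp: "(\<lambda>x. Re (u x)) \<in> Lp m p" "(\<lambda>x. Im (u x)) \<in> Lp m p"
    and T_u: "AE x in m. complexify T u x = (\<Sum>c\<in>C. of_real (\<tau> c x) * c)"
  proof -
    have *: "(\<lambda>x. h (u x)) \<in> Lp m p \<and> (AE x in m. T (\<lambda>x. h (u x)) x = (\<Sum>c\<in>C. h c * \<tau> c x))"
      if h: "h 0 = 0" "h \<in> borel_measurable borel" for h :: "complex \<Rightarrow> real"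
    proof -
      note [measurable] = h(2)
      let ?s = "\<lambda>y. \<Sum>c\<in>C. h c * indicator (A c) y"
      have eq: "?s x = h (u x)" if "x \<in> space m" for x
        using expand[OF that, of h] h(1) by (simp add: mult.commute)
      have s: "?s \<in> Lp m p" "AE x in m. T ?s x = (\<Sum>c\<in>C. h c * \<tau> c x)"
        using linear_sum[OF C(1), of "\<lambda>c. indicator (A c)" h, OF ind_Lp] by (auto simp: \<tau>_def)
      have "integrable m (\<lambda>x. \<bar>?s x\<bar> powr p) \<longleftrightarrow> integrable m (\<lambda>x. \<bar>h (u x)\<bar> powr p)"
        by (rule Bochner_Integration.integrable_cong) (simp_all add: eq)
      then have hu: "(\<lambda>x. h (u x)) \<in> Lp m p" using LpD(2)[OF s(1)] by (auto simp: Lp_def)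
      have "AE x in m. T (\<lambda>x. h (u x)) x = T ?s x"
        by (rule cong_AE[OF hu s(1)]) (auto simp: eq)
      then show ?thesis using s(2) hu by auto
    qed
    show "(\<lambda>x. Re (u x)) \<in> Lp m p" "(\<lambda>x. Im (u x)) \<in> Lp m p"
      using *[of Re] *[of Im] by auto
    have "AE x in m. T (\<lambda>x. Re (u x)) x = (\<Sum>c\<in>C. Re c * \<tau> c x)"
      "AE x in m. T (\<lambda>x. Im (u x)) x = (\<Sum>c\<in>C. Im c * \<tau> c x)"
      using *[of Re] *[of Im] by auto
    then show "AE x in m. complexify T u x = (\<Sum>c\<in>C. of_real (\<tau> c x) * c)"
      by eventually_elim (simp add: complexify_def complex_eq_iff mult.commute)
  qed
  have \<tau>_nonneg: "AE x in m. \<forall>c\<in>C. 0 \<le> \<tau> c x"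
    unfolding \<tau>_def using indicator_bounds[OF A_meas A_fin] C(1)
    by (subst AE_ball_countable[OF countable_finite]) auto
  have \<tau>_sum: "AE x in m. (\<Sum>c\<in>C. \<tau> c x) \<le> 1"
  proof -
    let ?U = "{x\<in>space m. u x \<noteq> 0}"
    have eq: "indicator ?U x = (\<Sum>c\<in>C. 1 * indicator (A c) x :: real)" if "x \<in> space m" for x
      using expand[OF that, of "\<lambda>_. 1"] that by (simp add: indicator_def)
    have s: "(\<lambda>x. \<Sum>c\<in>C. 1 * indicator (A c) x) \<in> Lp m p"
      "AE x in m. T (\<lambda>x. \<Sum>c\<in>C. 1 * indicator (A c) x) x = (\<Sum>c\<in>C. 1 * \<tau> c x)"
      using linear_sum[OF C(1), of "\<lambda>c. indicator (A c)" "\<lambda>_. 1", OF ind_Lp] by (auto simp: \<tau>_def)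
    have U: "indicator ?U \<in> Lp m p" by (rule Lp_indicator) (use u(2) in auto)
    have "AE x in m. T (indicator ?U) x = T (\<lambda>x. \<Sum>c\<in>C. 1 * indicator (A c) x) x"
      by (rule cong_AE[OF U s(1)]) (use eq in auto)
    moreover have "AE x in m. T (indicator ?U) x \<le> 1"
      using indicator_bounds[of ?U] u(2) by auto
    ultimately show ?thesis using s(2) by eventually_elim simp
  qed
  define G where "G = (\<lambda>a b. cmod ((1 - \<eta>) * a + \<eta> * b) powr p)"
  define K where "K = (\<lambda>a. cmod a powr p)"
  define t where "t = (\<lambda>c d. \<integral>x. \<tau> c x * indicator (A d) x \<partial>m)"
  define I where "I = (\<lambda>c. \<integral>x. \<tau> c x \<partial>m)"
  define \<mu> where "\<mu> = (\<lambda>c. measure m (A c))"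
  \<comment> \<open>The right-hand side of Jensen's inequality, written as a combination of products of the \<open>\<tau> c\<close> with
    indicators, so that its integral can be read off.\<close>
  define R where "R = (\<lambda>x. (\<Sum>c\<in>C. (\<Sum>d\<in>C. (\<tau> c x * indicator (A d) x) * G d c)
      + (\<tau> c x - (\<Sum>d\<in>C. \<tau> c x * indicator (A d) x)) * G 0 c)
    + (\<Sum>d\<in>C. (indicator (A d) x - (\<Sum>c\<in>C. \<tau> c x * indicator (A d) x)) * G d 0))"
  have G: "0 \<le> G c d" "G c d + G d c \<le> K c + K d" "K 0 = 0" "G 0 0 = 0" for c d
    using two_point[of c d] by (simp_all add: G_def K_def)
  have \<tau>_int: "integrable m (\<tau> c)" if "c \<in> C" for c
    unfolding \<tau>_def by (rule indicator_integrable) (use A_fin[OF that] in auto)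
  have \<tau>A_int: "integrable m (\<lambda>x. \<tau> c x * indicator (A d) x)" if "c \<in> C" for c d
    by (rule integrable_mult_indicator[OF A_meas \<tau>_int[OF that], simplified, unfolded real_scaleR_def mult.commute[of "indicator _ _"]])
  have A_int: "integrable m (\<lambda>x. indicator (A d) x :: real)" if "d \<in> C" for d
    using A_fin[OF that] by simp
  have R_int: "integrable m R"
    unfolding R_def using \<tau>_int \<tau>A_int A_int by (auto intro!: Bochner_Integration.integrable_add Bochner_Integration.integrable_sum integrable_mult_left Bochner_Integration.integrable_diff)
  have R_integral: "(\<integral>x. R x \<partial>m) = (\<Sum>c\<in>C. (\<Sum>d\<in>C. t c d * G d c) + (I c - (\<Sum>d\<in>C. t c d)) * G 0 c)
      + (\<Sum>d\<in>C. (\<mu> d - (\<Sum>c\<in>C. t c d)) * G d 0)"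
    unfolding R_def t_def I_def \<mu>_def
    by (simp add: Bochner_Integration.integral_add Bochner_Integration.integral_sum
        Bochner_Integration.integral_diff \<tau>_int \<tau>A_int A_int)
  have pointwise: "AE x in m. cmod ((1 - \<eta>) * u x + \<eta> * complexify T u x) powr p \<le> R x"
    using T_u \<tau>_nonneg \<tau>_sum AE_space
  proof eventually_elim
    case (elim x)
    define a where "a = (\<lambda>c. if c = 0 then 1 - (\<Sum>c\<in>C. \<tau> c x) else \<tau> c x)"
    have a_C: "a c = \<tau> c x" if "c \<in> C" for c using that C by (auto simp: a_def)
    have sum_a: "(\<Sum>c\<in>insert 0 C. a c) = 1"
      using C by (simp add: a_C) (simp add: a_def)
    have "(1 - \<eta>) * u x + \<eta> * complexify T u x
        = (\<Sum>c\<in>insert 0 C. of_real (a c) * ((1 - \<eta>) * u x + \<eta> * c))"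
    proof -
      have "(\<Sum>c\<in>insert 0 C. of_real (a c) * ((1 - \<eta>) * u x + \<eta> * c))
        = of_real (\<Sum>c\<in>insert 0 C. a c) * ((1 - \<eta>) * u x) + \<eta> * (\<Sum>c\<in>insert 0 C. of_real (a c) * c)"
        by (simp only: of_real_sum sum_distrib_right sum_distrib_left distrib_left sum.distrib mult_ac)
      also have "(\<Sum>c\<in>insert 0 C. of_real (a c) * c) = complexify T u x"
        using C by (simp add: elim(1) a_C)
      finally show ?thesis by (simp add: sum_a)
    qed
    moreover have "0 \<le> a c" if "c \<in> insert 0 C" for c
      using that elim(2,3) by (auto simp: a_def)
    ultimately have "cmod ((1 - \<eta>) * u x + \<eta> * complexify T u x) powr p
        \<le> (\<Sum>c\<in>insert 0 C. a c * cmod ((1 - \<eta>) * u x + \<eta> * c) powr p)"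
      using jensen_cmod_powr[OF p, of "insert 0 C" a] sum_a C(1) by simp
    also have "\<dots> = (\<Sum>c\<in>C. \<tau> c x * G (u x) c) + (1 - (\<Sum>c\<in>C. \<tau> c x)) * G (u x) 0"
      using C by (simp add: a_C G_def) (simp add: a_def)
    also have "\<dots> = R x"
    proof -
      have 1: "(\<Sum>d\<in>C. (\<tau> c x * indicator (A d) x) * G d c)
          + (\<tau> c x - (\<Sum>d\<in>C. \<tau> c x * indicator (A d) x)) * G 0 c = \<tau> c x * G (u x) c" for c
        using expand[OF elim(4), of "\<lambda>d. G d c"] expand[OF elim(4), of "\<lambda>_. 1"]
        by (simp add: mult.assoc sum_distrib_left[symmetric])
      have 2: "(\<Sum>d\<in>C. (indicator (A d) x - (\<Sum>c\<in>C. \<tau> c x * indicator (A d) x)) * G d 0)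
          = (1 - (\<Sum>c\<in>C. \<tau> c x)) * G (u x) 0"
      proof -
        have "(indicator (A d) x - (\<Sum>c\<in>C. \<tau> c x * indicator (A d) x)) * G d 0
            = (1 - (\<Sum>c\<in>C. \<tau> c x)) * (indicator (A d) x * G d 0)" for d
          by (simp add: sum_distrib_right[symmetric] algebra_simps)
        then have "(\<Sum>d\<in>C. (indicator (A d) x - (\<Sum>c\<in>C. \<tau> c x * indicator (A d) x)) * G d 0)
            = (1 - (\<Sum>c\<in>C. \<tau> c x)) * (\<Sum>d\<in>C. indicator (A d) x * G d 0)"
          by (simp only: sum_distrib_left)
        then show ?thesis using expand[OF elim(4), of "\<lambda>d. G d 0"] G(4) by simp
      qed
      show ?thesis unfolding R_def 1 2 ..
    qed
    finally show ?case .
  qed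
  have "(\<integral>x. cmod ((1 - \<eta>) * u x + \<eta> * complexify T u x) powr p \<partial>m) \<le> (\<integral>x. R x \<partial>m)"
  proof (rule integral_mono_AE'[OF R_int pointwise])
    show "AE x in m. 0 \<le> R x"
      using pointwise by eventually_elim (rule order_trans[OF powr_ge_zero])
  qed
  also have "\<dots> \<le> (\<Sum>c\<in>C. \<mu> c * K c)"
    unfolding R_integral
  proof (rule symmetric_weights_sum_le[OF C(1)])
    fix c assume c: "c \<in> C"
    show "I c \<le> \<mu> c" unfolding I_def \<mu>_def \<tau>_def
      by (rule indicator_integral) (use A_fin[OF c] in auto)
    have "(\<Sum>d\<in>C. t c d) = (\<integral>x. (\<Sum>d\<in>C. \<tau> c x * indicator (A d) x) \<partial>m)"
      unfolding t_def using \<tau>A_int[OF c] by (simp add: Bochner_Integration.integral_sum)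
    also have "\<dots> \<le> I c" unfolding I_def
    proof (rule integral_mono_AE)
      show "AE x in m. (\<Sum>d\<in>C. \<tau> c x * indicator (A d) x) \<le> \<tau> c x"
        using \<tau>_nonneg AE_space
      proof eventually_elim
        case (elim x)
        show ?case using expand[OF elim(2), of "\<lambda>_. 1"] elim(1) c
          by (simp add: sum_distrib_left[symmetric])
      qed
    qed (use \<tau>A_int[OF c] \<tau>_int[OF c] in auto)
    finally show "(\<Sum>d\<in>C. t c d) \<le> I c" .
    fix d assume d: "d \<in> C"
    show "t c d = t d c" unfolding t_def \<tau>_def
      by (rule indicator_symmetric) (use A_fin c d in auto)
    show "0 \<le> t c d" unfolding t_def
      by (rule integral_nonneg_AE) (use \<tau>_nonneg c in \<open>auto simp: indicator_def\<close>)
  qed (use G in auto)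
  also have "(\<Sum>c\<in>C. \<mu> c * K c) = (\<integral>x. (\<Sum>c\<in>C. indicator (A c) x * K c) \<partial>m)"
    using A_int by (simp add: Bochner_Integration.integral_sum \<mu>_def)
  also have "\<dots> = (\<integral>x. cmod (u x) powr p \<partial>m)"
    by (rule Bochner_Integration.integral_cong) (auto simp: expand K_def)
  finally show ?thesis .
qed

text \<open>The general case follows by approximating \<open>u\<close> by simple functions \<open>s i\<close> dominated by \<open>2 \<bar>u\<bar>\<close>. The
  operator is continuous on \<open>L\<^sup>p\<close>, so along a subsequence the images converge almost everywhere,
  and Fatou's lemma passes the bound to the limit.\<close>
lemma two_point_step:
  fixes u :: "'a \<Rightarrow> complex"
  assumes u: "(\<lambda>x. Re (u x)) \<in> Lp m p" "(\<lambda>x. Im (u x)) \<in> Lp m p"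
    and two_point: "\<And>a b. cmod ((1 - \<eta>) * a + \<eta> * b) powr p + cmod ((1 - \<eta>) * b + \<eta> * a) powr p
      \<le> cmod a powr p + cmod b powr p"
  defines "v \<equiv> \<lambda>x. (1 - \<eta>) * u x + \<eta> * complexify T u x"
  shows "(\<lambda>x. Re (v x)) \<in> Lp m p \<and> (\<lambda>x. Im (v x)) \<in> Lp m p \<and>
    (\<integral>x. cmod (v x) powr p \<partial>m) \<le> (\<integral>x. cmod (u x) powr p \<partial>m)"
proof -
  have p0: "0 < p" using p by simp
  have u': "u \<in> borel_measurable m" "integrable m (\<lambda>x. cmod (u x) powr p)"
    using complex_Lp_iff[OF p0, of u m] u by auto
  note [measurable] = u'(1)
  have Tu_Lp: "T (\<lambda>x. Re (u x)) \<in> Lp m p" "T (\<lambda>x. Im (u x)) \<in> Lp m p"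
    using u by (auto intro: maps_Lp)
  have v_Lp: "(\<lambda>x. Re (v x)) \<in> Lp m p" "(\<lambda>x. Im (v x)) \<in> Lp m p"
  proof -
    have "(\<lambda>x. Re (v x)) = (\<lambda>x. 1 * (Re (1 - \<eta>) * Re (u x) + (- Im (1 - \<eta>)) * Im (u x))
        + 1 * (Re \<eta> * T (\<lambda>x. Re (u x)) x + (- Im \<eta>) * T (\<lambda>x. Im (u x)) x))"
      by (simp add: v_def complexify_def)
    also have "\<dots> \<in> Lp m p" by (intro Lp_lincomb) (use p u Tu_Lp in auto)
    finally show "(\<lambda>x. Re (v x)) \<in> Lp m p" .
    have "(\<lambda>x. Im (v x)) = (\<lambda>x. 1 * (Re (1 - \<eta>) * Im (u x) + Im (1 - \<eta>) * Re (u x))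
        + 1 * (Re \<eta> * T (\<lambda>x. Im (u x)) x + Im \<eta> * T (\<lambda>x. Re (u x)) x))"
      by (simp add: v_def complexify_def)
    also have "\<dots> \<in> Lp m p" by (intro Lp_lincomb) (use p u Tu_Lp in auto)
    finally show "(\<lambda>x. Im (v x)) \<in> Lp m p" .
  qed
  obtain s where s: "\<And>i. simple_function m (s i)" "\<And>x. x \<in> space m \<Longrightarrow> (\<lambda>i. s i x) \<longlonglongrightarrow> u x"
    "\<And>i x. x \<in> space m \<Longrightarrow> cmod (s i x) \<le> 2 * cmod (u x)"
    using borel_measurable_implies_sequence_metric[OF u'(1), of 0] unfolding dist_norm diff_zero by metis
  have s_meas[measurable]: "s i \<in> borel_measurable m" for i by (rule borel_measurable_simple_function[OF s(1)])
  have dom: "integrable m (\<lambda>x. 3 powr p * cmod (u x) powr p)" using u'(2) by auto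
  have s_le: "cmod (s i x) powr p \<le> 3 powr p * cmod (u x) powr p"
    "cmod (s i x - u x) powr p \<le> 3 powr p * cmod (u x) powr p" if "x \<in> space m" for i x
  proof -
    have "cmod (s i x) \<le> 3 * cmod (u x)" "cmod (s i x - u x) \<le> 3 * cmod (u x)"
      using s(3)[OF that, of i] norm_ge_zero[of "u x"] norm_triangle_ineq4[of "s i x" "u x"] by linarith+
    from this[THEN powr_mono2[rotated 2, of _ _ p]]
    show "cmod (s i x) powr p \<le> 3 powr p * cmod (u x) powr p"
      "cmod (s i x - u x) powr p \<le> 3 powr p * cmod (u x) powr p"
      using p0 by (simp_all add: powr_mult)
  qed
  have s_int: "integrable m (\<lambda>x. cmod (s i x) powr p)" for i
    by (rule Bochner_Integration.integrable_bound[OF dom]) (use s_le in auto)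
  have s_Lp: "(\<lambda>x. Re (s i x)) \<in> Lp m p" "(\<lambda>x. Im (s i x)) \<in> Lp m p" for i
    using complex_Lp_iff[OF p0, of "s i" m] s_int by auto
  have s_fin: "emeasure m {x\<in>space m. s i x \<noteq> 0} < \<infinity>" for i
  proof -
    have sf: "simple_function m (\<lambda>x. ennreal (cmod (s i x) powr p))"
      by (rule simple_function_compose1[OF s(1), of "\<lambda>z. ennreal (cmod z powr p)"])
    have "(\<integral>\<^sup>+x. ennreal (cmod (s i x) powr p) \<partial>m) < \<infinity>"
      by (subst nn_integral_eq_integral[OF s_int]) auto
    from simple_function_finite_support[OF sf this]
    have "emeasure m {x\<in>space m. ennreal (cmod (s i x) powr p) \<noteq> 0} \<noteq> \<infinity>" by simp
    moreover have "{x\<in>space m. ennreal (cmod (s i x) powr p) \<noteq> 0} = {x\<in>space m. s i x \<noteq> 0}"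
      by (auto simp: ennreal_eq_0_iff)
    ultimately show ?thesis by (simp add: top.not_eq_extremum)
  qed
  have conv: "(\<lambda>i. \<integral>x. cmod (s i x - u x) powr p \<partial>m) \<longlonglongrightarrow> (\<integral>x. 0 \<partial>m)"
  proof (rule integral_dominated_convergence[OF _ _ dom])
    show "AE x in m. (\<lambda>i. cmod (s i x - u x) powr p) \<longlonglongrightarrow> 0"
    proof (rule AE_I2)
      fix x assume "x \<in> space m"
      then have "(\<lambda>i. cmod (s i x - u x)) \<longlonglongrightarrow> 0" using s(2) by (simp add: LIM_zero tendsto_norm_zero)
      then have "(\<lambda>i. cmod (s i x - u x) powr p) \<longlonglongrightarrow> 0 powr p"
        by (rule tendsto_powr'[OF _ tendsto_const]) (use p0 in auto)
      then show "(\<lambda>i. cmod (s i x - u x) powr p) \<longlonglongrightarrow> 0" by simp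
    qed
  qed (use s_le in auto)
  have conv': "(\<lambda>i. \<integral>x. cmod (s i x) powr p \<partial>m) \<longlonglongrightarrow> (\<integral>x. cmod (u x) powr p \<partial>m)"
  proof (rule integral_dominated_convergence[OF _ _ dom])
    show "AE x in m. (\<lambda>i. cmod (s i x) powr p) \<longlonglongrightarrow> cmod (u x) powr p"
      using s(2) p0 by (auto intro!: AE_I2 tendsto_powr' tendsto_norm tendsto_const)
  qed (use s_le in auto)
  \<comment> \<open>One subsequence must serve the real and the imaginary parts, hence the sum.\<close>
  define w where "w = (\<lambda>i x. \<bar>T (\<lambda>y. Re (s i y)) x - T (\<lambda>y. Re (u y)) x\<bar> powr p
      + \<bar>T (\<lambda>y. Im (s i y)) x - T (\<lambda>y. Im (u y)) x\<bar> powr p)"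
  have T_diff: "(\<lambda>x. T (\<lambda>y. Re (s i y)) x - T (\<lambda>y. Re (u y)) x) \<in> Lp m p"
    "(\<lambda>x. T (\<lambda>y. Im (s i y)) x - T (\<lambda>y. Im (u y)) x) \<in> Lp m p" for i
    by (intro Lp_diff maps_Lp s_Lp u, use p0 in simp)+
  have w_int: "integrable m (w i)" for i
    unfolding w_def using T_diff[THEN LpD(2)] by auto
  have su_int: "integrable m (\<lambda>x. cmod (s i x - u x) powr p)" for i
    by (rule Bochner_Integration.integrable_bound[OF dom]) (use s_le in auto)
  have w_le: "(\<integral>x. norm (w i x) \<partial>m) \<le> 2 * (\<integral>x. cmod (s i x - u x) powr p \<partial>m)" for i
  proof -
    have "(\<integral>x. norm (w i x) \<partial>m) = (\<integral>x. w i x \<partial>m)" by (simp add: w_def)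
    also have "\<dots> \<le> (\<integral>x. \<bar>Re (s i x) - Re (u x)\<bar> powr p \<partial>m) + (\<integral>x. \<bar>Im (s i x) - Im (u x)\<bar> powr p \<partial>m)"
      unfolding w_def using T_diff[THEN LpD(2)] contraction_diff[OF s_Lp(1) u(1), of i]
        contraction_diff[OF s_Lp(2) u(2), of i] by simp
    also have "\<dots> \<le> 2 * (\<integral>x. cmod (s i x - u x) powr p \<partial>m)"
    proof -
      have "(\<integral>x. \<bar>Re (s i x) - Re (u x)\<bar> powr p \<partial>m) \<le> (\<integral>x. cmod (s i x - u x) powr p \<partial>m)"
        using p0 abs_Re_le_cmod[of "s i x - u x" for x]
        by (intro integral_mono_AE'[OF su_int]) (auto intro!: AE_I2 powr_mono2)
      moreover have "(\<integral>x. \<bar>Im (s i x) - Im (u x)\<bar> powr p \<partial>m) \<le> (\<integral>x. cmod (s i x - u x) powr p \<partial>m)"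
        using p0 abs_Im_le_cmod[of "s i x - u x" for x]
        by (intro integral_mono_AE'[OF su_int]) (auto intro!: AE_I2 powr_mono2)
      ultimately show ?thesis by simp
    qed
    finally show ?thesis .
  qed
  have "(\<lambda>i. 2 * (\<integral>x. cmod (s i x - u x) powr p \<partial>m)) \<longlonglongrightarrow> 0"
    using tendsto_mult_left[OF conv, of 2] by simp
  then have "(\<lambda>i. \<integral>x. norm (w i x) \<partial>m) \<longlonglongrightarrow> 0"
    by (rule Lim_null_comparison[rotated]) (use w_le in \<open>simp add: integral_nonneg_AE\<close>)
  from tendsto_L1_AE_subseq[OF w_int this]
  obtain r where r: "strict_mono r" "AE x in m. (\<lambda>n. w (r n) x) \<longlonglongrightarrow> 0" by auto
  define vs where "vs = (\<lambda>n x. (1 - \<eta>) * s (r n) x + \<eta> * complexify T (s (r n)) x)"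
  have vs_conv: "AE x in m. (\<lambda>n. vs n x) \<longlonglongrightarrow> v x"
    using r(2) AE_space
  proof eventually_elim
    case (elim x)
    have root: "(\<lambda>n. c n) \<longlonglongrightarrow> l" if "\<And>n. \<bar>c n - l\<bar> powr p \<le> w (r n) x" for c :: "nat \<Rightarrow> real" and l
    proof -
      have "(\<lambda>n. \<bar>c n - l\<bar> powr p) \<longlonglongrightarrow> 0"
        by (rule tendsto_sandwich[OF _ _ tendsto_const elim(1)]) (use that in auto)
      then have "(\<lambda>n. (\<bar>c n - l\<bar> powr p) powr (1 / p)) \<longlonglongrightarrow> 0 powr (1 / p)"
        by (rule tendsto_powr'[OF _ tendsto_const]) (use p0 in auto)
      then show ?thesis using p0 by (simp add: powr_powr tendsto_rabs_zero_iff LIM_zero_iff)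
    qed
    have "(\<lambda>n. T (\<lambda>y. Re (s (r n) y)) x) \<longlonglongrightarrow> T (\<lambda>y. Re (u y)) x"
      "(\<lambda>n. T (\<lambda>y. Im (s (r n) y)) x) \<longlonglongrightarrow> T (\<lambda>y. Im (u y)) x"
      by (rule root, simp add: w_def)+
    then have "(\<lambda>n. complexify T (s (r n)) x) \<longlonglongrightarrow> complexify T u x"
      unfolding complexify_def by (rule tendsto_Complex)
    moreover have "(\<lambda>n. s (r n) x) \<longlonglongrightarrow> u x"
      using LIMSEQ_subseq_LIMSEQ[OF s(2)[OF elim(2)] r(1)] by (simp add: o_def)
    ultimately show ?case unfolding vs_def v_def by (intro tendsto_intros)
  qed
  have vs_meas: "vs n \<in> borel_measurable m" for n
  proof -
    have "(\<lambda>x. Re (complexify T (s (r n)) x)) \<in> Lp m p" "(\<lambda>x. Im (complexify T (s (r n)) x)) \<in> Lp m p"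
      unfolding complexify_def complex.sel by (rule maps_Lp[OF s_Lp(1)], rule maps_Lp[OF s_Lp(2)])
    then have "complexify T (s (r n)) \<in> borel_measurable m"
      using complex_Lp_iff[OF p0, of "complexify T (s (r n))" m] by blast
    then show ?thesis unfolding vs_def by measurable
  qed
  have vs_int: "integrable m (\<lambda>x. cmod (vs n x) powr p)" for n
  proof -
    have "(\<lambda>x. Re (vs n x)) = (\<lambda>x. 1 * (Re (1 - \<eta>) * Re (s (r n) x) + (- Im (1 - \<eta>)) * Im (s (r n) x))
        + 1 * (Re \<eta> * T (\<lambda>x. Re (s (r n) x)) x + (- Im \<eta>) * T (\<lambda>x. Im (s (r n) x)) x))"
      by (simp add: vs_def complexify_def)
    also have "\<dots> \<in> Lp m p" by (intro Lp_lincomb maps_Lp s_Lp) (use p0 in auto)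
    finally have 1: "(\<lambda>x. Re (vs n x)) \<in> Lp m p" .
    have "(\<lambda>x. Im (vs n x)) = (\<lambda>x. 1 * (Re (1 - \<eta>) * Im (s (r n) x) + Im (1 - \<eta>) * Re (s (r n) x))
        + 1 * (Re \<eta> * T (\<lambda>x. Im (s (r n) x)) x + Im \<eta> * T (\<lambda>x. Re (s (r n) x)) x))"
      by (simp add: vs_def complexify_def)
    also have "\<dots> \<in> Lp m p" by (intro Lp_lincomb maps_Lp s_Lp) (use p0 in auto)
    finally have 2: "(\<lambda>x. Im (vs n x)) \<in> Lp m p" .
    show ?thesis using complex_Lp_iff[OF p0, of "vs n" m] 1 2 by auto
  qed
  have v_int: "integrable m (\<lambda>x. cmod (v x) powr p)" using complex_Lp_iff[OF p0, of v m] v_Lp by auto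
  have "ennreal (\<integral>x. cmod (v x) powr p \<partial>m) = (\<integral>\<^sup>+x. ennreal (cmod (v x) powr p) \<partial>m)"
    by (rule nn_integral_eq_integral[symmetric, OF v_int]) simp
  also have "\<dots> = (\<integral>\<^sup>+x. liminf (\<lambda>n. ennreal (cmod (vs n x) powr p)) \<partial>m)"
  proof (rule nn_integral_cong_AE)
    show "AE x in m. ennreal (cmod (v x) powr p) = liminf (\<lambda>n. ennreal (cmod (vs n x) powr p))"
      using vs_conv
    proof eventually_elim
      case (elim x)
      have "(\<lambda>n. cmod (vs n x) powr p) \<longlonglongrightarrow> cmod (v x) powr p"
        by (rule tendsto_powr'[OF tendsto_norm[OF elim] tendsto_const]) (use p0 in auto)
      then have "(\<lambda>n. ennreal (cmod (vs n x) powr p)) \<longlonglongrightarrow> ennreal (cmod (v x) powr p)"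
        by (rule tendsto_ennrealI)
      then show ?case using lim_imp_Liminf[OF trivial_limit_sequentially] by metis
    qed
  qed
  also have "\<dots> \<le> liminf (\<lambda>n. \<integral>\<^sup>+x. ennreal (cmod (vs n x) powr p) \<partial>m)"
    by (rule nn_integral_liminf) (use vs_meas in measurable)
  also have "\<dots> \<le> liminf (\<lambda>n. ennreal (\<integral>x. cmod (s (r n) x) powr p \<partial>m))"
  proof (rule Liminf_mono, rule always_eventually, rule allI)
    fix n
    have "(\<integral>\<^sup>+x. ennreal (cmod (vs n x) powr p) \<partial>m) = ennreal (\<integral>x. cmod (vs n x) powr p \<partial>m)"
      by (rule nn_integral_eq_integral[OF vs_int]) simp
    also have "\<dots> \<le> ennreal (\<integral>x. cmod (s (r n) x) powr p \<partial>m)"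
      unfolding vs_def by (intro ennreal_leI two_point_step_simple s(1) s_fin two_point)
    finally show "(\<integral>\<^sup>+x. ennreal (cmod (vs n x) powr p) \<partial>m) \<le> ennreal (\<integral>x. cmod (s (r n) x) powr p \<partial>m)" .
  qed
  also have "\<dots> = ennreal (\<integral>x. cmod (u x) powr p \<partial>m)"
    using LIMSEQ_subseq_LIMSEQ[OF conv' r(1)]
    by (intro lim_imp_Liminf tendsto_ennrealI) (auto simp: o_def)
  finally have "(\<integral>x. cmod (v x) powr p \<partial>m) \<le> (\<integral>x. cmod (u x) powr p \<partial>m)"
    by (subst (asm) ennreal_le_iff) (auto simp: integral_nonneg_AE)
  then show ?thesis using v_Lp by blast
qed

end

section \<open>A sectorial bound for binomial means forces differentiability\<close>
text \<open>If \<open>c k\<close> is obtained by applying the \<open>k\<close>-th power of \<open>T\<close>, this is the result of applying the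
  \<open>n\<close>-th power of \<open>(1 - \<eta>) + \<eta> T\<close>. For real \<open>\<eta>\<close> it is a Bernstein polynomial.\<close>
definition binomial_mean :: "complex \<Rightarrow> nat \<Rightarrow> (nat \<Rightarrow> complex) \<Rightarrow> complex" where
  "binomial_mean \<eta> n c = (\<Sum>k\<le>n. of_nat (n choose k) * \<eta> ^ k * (1 - \<eta>) ^ (n - k) * c k)"

lemma binomial_mean_Suc:
  "binomial_mean \<eta> (Suc n) c = binomial_mean \<eta> n (\<lambda>k. (1 - \<eta>) * c k + \<eta> * c (Suc k))"
proof -
  define b where "b = (\<lambda>k. \<eta> ^ k * (1 - \<eta>) ^ (Suc n - k) * c k)"
  have "binomial_mean \<eta> (Suc n) c = b 0 + (\<Sum>k\<le>n. of_nat (Suc n choose Suc k) * b (Suc k))"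
    unfolding binomial_mean_def b_def by (subst sum.atMost_Suc_shift) (simp add: mult.assoc)
  also have "\<dots> = (b 0 + (\<Sum>k\<le>n. of_nat (n choose Suc k) * b (Suc k))) + (\<Sum>k\<le>n. of_nat (n choose k) * b (Suc k))"
    by (simp add: distrib_right sum.distrib algebra_simps)
  also have "b 0 + (\<Sum>k\<le>n. of_nat (n choose Suc k) * b (Suc k)) = (\<Sum>k\<le>Suc n. of_nat (n choose k) * b k)"
    by (subst sum.atMost_Suc_shift) simp
  also have "\<dots> = (\<Sum>k\<le>n. of_nat (n choose k) * b k)" by (simp add: binomial_eq_0)
  also have "\<dots> + (\<Sum>k\<le>n. of_nat (n choose k) * b (Suc k))
      = binomial_mean \<eta> n (\<lambda>k. (1 - \<eta>) * c k + \<eta> * c (Suc k))"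
    unfolding binomial_mean_def sum.distrib[symmetric] b_def
    by (intro sum.cong refl) (simp add: Suc_diff_le algebra_simps)
  finally show ?thesis .
qed

lemma binomial_mean_of_real:
  "binomial_mean (of_real x) n (\<lambda>k. of_real (c k)) = of_real (\<Sum>k\<le>n. Bernstein n k x * c k)"
  by (simp add: binomial_mean_def Bernstein_def)

lemma Bernstein_second_moment:
  assumes "0 < N" "0 \<le> t"
  defines "x \<equiv> (t / N) / (2 * (1 + t / N))"
  shows "(\<Sum>k\<le>2 * N\<^sup>2. Bernstein (2 * N\<^sup>2) k x * (k / N - t)\<^sup>2) \<le> t ^ 4 / (real N)\<^sup>2 + t / N"
proof -
  define n where "n = 2 * N\<^sup>2"
  define \<tau> where "\<tau> = t / (1 + t / N)"
  have N: "0 < real N" using assms by simp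
  have x: "x = \<tau> / (2 * N)" using N by (simp add: x_def \<tau>_def)
  have pos: "0 < 1 + t / N" using assms by (simp add: add_pos_nonneg)
  have "\<tau> * (1 + t / N) = t" using pos by (simp add: \<tau>_def)
  then have \<tau>3: "t - \<tau> = \<tau> * t / N" by (simp add: algebra_simps)
  have \<tau>0: "0 \<le> \<tau>" using pos assms(2) by (simp add: \<tau>_def)
  then have "0 \<le> \<tau> * t / N" using assms(2) by simp
  with \<tau>0 \<tau>3 have \<tau>: "0 \<le> \<tau>" "\<tau> \<le> t" "t - \<tau> = \<tau> * t / N" by auto
  have "(\<Sum>k\<le>n. Bernstein n k x * (k / N - t)\<^sup>2)
    = (\<Sum>k\<le>n. real k * (real k - 1) * Bernstein n k x) / (real N)\<^sup>2
      + (1 / (real N)\<^sup>2 - 2 * t / N) * (\<Sum>k\<le>n. real k * Bernstein n k x) + t\<^sup>2 * (\<Sum>k\<le>n. Bernstein n k x)"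
  proof -
    have "Bernstein n k x * (k / N - t)\<^sup>2 = real k * (real k - 1) * Bernstein n k x / (real N)\<^sup>2
        + (1 / (real N)\<^sup>2 - 2 * t / N) * (real k * Bernstein n k x) + t\<^sup>2 * Bernstein n k x" for k
      using N by (simp add: field_simps power2_eq_square)
    then show ?thesis by (simp only: sum.distrib sum_distrib_left sum_divide_distrib)
  qed
  also have "\<dots> = real n * (real n - 1) * x\<^sup>2 / (real N)\<^sup>2 + (1 / (real N)\<^sup>2 - 2 * t / N) * (real n * x) + t\<^sup>2"
    by simp
  also have "\<dots> = (\<tau> - t)\<^sup>2 + \<tau> / N - x\<^sup>2 * 2"
    unfolding n_def x using N by (simp add: field_simps power2_eq_square)
  also have "\<dots> \<le> (\<tau> - t)\<^sup>2 + \<tau> / N" by simp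
  also have "(\<tau> - t)\<^sup>2 = (\<tau> * t / N)\<^sup>2" using \<tau>(3) by (metis power2_commute)
  also have "\<dots> \<le> (t * t / N)\<^sup>2"
    using \<tau> N assms(2) by (intro power_mono divide_right_mono mult_right_mono) auto
  also have "(t * t / N)\<^sup>2 = t ^ 4 / (real N)\<^sup>2" by (simp add: power_divide power2_eq_square power4_eq_xxxx)
  also have "\<tau> / N \<le> t / N" using \<tau> N by (simp add: divide_right_mono)
  finally show ?thesis by (simp add: n_def)
qed

text \<open>With time step \<open>1 / N\<close> and \<open>\<eta>\<close> close to \<open>\<zeta> / (2 N)\<close>, the \<open>2 N\<^sup>2\<close> steps have a total length with mean
  close to \<open>\<zeta>\<close> and variance of order \<open>1 / N\<close>. For real \<open>\<zeta>\<close> the approximants therefore converge to \<open>h \<zeta>\<close>,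
  while for complex \<open>\<zeta>\<close> the two-point bound keeps them under control.\<close>
definition binomial_approximant :: "(real \<Rightarrow> real) \<Rightarrow> nat \<Rightarrow> complex \<Rightarrow> complex" where
  "binomial_approximant h N \<zeta> = binomial_mean ((\<zeta> / N) / (2 * (1 + \<zeta> / N))) (2 * N\<^sup>2) (\<lambda>k. of_real (h (k / N)))"

text \<open>Bernstein's argument: the binomial weights concentrate near \<open>t\<close> by the second moment bound, and
  away from \<open>t\<close> the bounded function \<open>h\<close> is dominated by a multiple of \<open>(s - t)\<^sup>2\<close>.\<close>
lemma binomial_approximant_tendsto:
  assumes M: "\<And>t. 0 \<le> t \<Longrightarrow> \<bar>h t\<bar> \<le> M" and t: "0 < t" and cont: "isCont h t"
  shows "(\<lambda>N. binomial_approximant h (Suc N) (of_real t)) \<longlonglongrightarrow> of_real (h t)"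
proof -
  define x where "x = (\<lambda>N. (t / Suc N) / (2 * (1 + t / Suc N)))"
  define n where "n = (\<lambda>N. 2 * (Suc N)\<^sup>2)"
  define S where "S = (\<lambda>N. \<Sum>k\<le>n N. Bernstein (n N) k (x N) * h (k / Suc N))"
  have eq: "binomial_approximant h (Suc N) (of_real t) = of_real (S N)" for N
  proof -
    have "complex_of_real t / of_nat (Suc N) / (2 * (1 + complex_of_real t / of_nat (Suc N))) = of_real (x N)"
      by (simp add: x_def)
    then show ?thesis unfolding binomial_approximant_def S_def n_def by (simp only: binomial_mean_of_real)
  qed
  have x: "0 \<le> x N" "x N \<le> 1" for N
  proof -
    have "0 \<le> q / (2 * (1 + q)) \<and> q / (2 * (1 + q)) \<le> 1" if "0 \<le> q" for q :: real
      using that by (auto simp: divide_le_eq_1)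
    from this[of "t / Suc N"] show "0 \<le> x N" "x N \<le> 1" unfolding x_def using t by auto
  qed
  have "0 \<le> M" using M[of 0] by linarith
  have "S \<longlonglongrightarrow> h t"
  proof (rule LIMSEQ_I)
    fix e :: real assume e: "0 < e"
    obtain d where d: "0 < d" "\<And>s. \<bar>s - t\<bar> < d \<Longrightarrow> \<bar>h s - h t\<bar> < e / 2"
      using cont[unfolded continuous_at_eps_delta, rule_format, of "e / 2"] e by (auto simp: dist_real_def)
    define c where "c = 2 * M / d\<^sup>2"
    have c: "0 \<le> c" using \<open>0 \<le> M\<close> by (simp add: c_def)
    have le: "\<bar>h s - h t\<bar> \<le> e / 2 + c * (s - t)\<^sup>2" if "0 \<le> s" for s
    proof (cases "\<bar>s - t\<bar> < d")
      case True
      then show ?thesis using d(2)[OF True] c by (simp add: add_increasing2)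
    next
      case False
      then have "d\<^sup>2 \<le> (s - t)\<^sup>2" using d(1) by (simp add: abs_le_square_iff[symmetric])
      then have "2 * M \<le> c * (s - t)\<^sup>2"
        using mult_left_mono[of "d\<^sup>2" "(s - t)\<^sup>2" c] c d(1) by (simp add: c_def)
      moreover have "\<bar>h s - h t\<bar> \<le> 2 * M" using M[OF that] M[of t] t by linarith
      ultimately show ?thesis using e by linarith
    qed
    have est: "\<bar>S N - h t\<bar> \<le> e / 2 + c * (t ^ 4 / (real (Suc N))\<^sup>2 + t / Suc N)" for N
    proof -
      let ?B = "\<lambda>k. Bernstein (n N) k (x N)"
      have B: "0 \<le> ?B k" for k by (rule Bernstein_nonneg) (use x in auto)
      have "S N - h t = (\<Sum>k\<le>n N. ?B k * h (k / Suc N)) - (\<Sum>k\<le>n N. ?B k) * h t"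
        by (simp add: S_def)
      also have "\<dots> = (\<Sum>k\<le>n N. ?B k * (h (k / Suc N) - h t))"
        by (simp only: sum_distrib_right right_diff_distrib sum_subtractf)
      also have "\<bar>\<dots>\<bar> \<le> (\<Sum>k\<le>n N. ?B k * \<bar>h (k / Suc N) - h t\<bar>)"
        by (rule order_trans[OF sum_abs]) (simp add: abs_mult B)
      also have "\<dots> \<le> (\<Sum>k\<le>n N. ?B k * (e / 2 + c * (k / Suc N - t)\<^sup>2))"
        by (intro sum_mono mult_left_mono le B) simp
      also have "\<dots> = (\<Sum>k\<le>n N. ?B k) * (e / 2) + c * (\<Sum>k\<le>n N. ?B k * (k / Suc N - t)\<^sup>2)"
        by (simp only: sum_distrib_right sum_distrib_left distrib_left sum.distrib mult_ac)
      also have "(\<Sum>k\<le>n N. ?B k) * (e / 2) = e / 2" by simp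
      also have "(\<Sum>k\<le>n N. ?B k * (k / Suc N - t)\<^sup>2) \<le> t ^ 4 / (real (Suc N))\<^sup>2 + t / Suc N"
        unfolding n_def x_def by (rule Bernstein_second_moment) (use t in auto)
      finally show ?thesis using c by (simp add: mult_left_mono)
    qed
    have "(\<lambda>N. c * (t ^ 4 / (real (Suc N))\<^sup>2 + t / Suc N)) \<longlonglongrightarrow> c * (t ^ 4 * 0 + t * 0)"
    proof -
      have 1: "(\<lambda>N. 1 / real (Suc N)) \<longlonglongrightarrow> 0" using LIMSEQ_inverse_real_of_nat by (simp add: inverse_eq_divide)
      then have 2: "(\<lambda>N. (1 / real (Suc N)) ^ 2) \<longlonglongrightarrow> 0 ^ 2" by (rule tendsto_power)
      have "(\<lambda>N. c * (t ^ 4 * (1 / real (Suc N)) ^ 2 + t * (1 / real (Suc N)))) \<longlonglongrightarrow> c * (t ^ 4 * 0 ^ 2 + t * 0)"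
        by (intro tendsto_intros 1 2)
      then show ?thesis by (simp add: power_divide)
    qed
    then have "\<forall>\<^sub>F N in sequentially. c * (t ^ 4 / (real (Suc N))\<^sup>2 + t / Suc N) < e / 2"
      by (rule order_tendstoD(2)) (use e in simp)
    then obtain N0 where "\<And>N. N0 \<le> N \<Longrightarrow> c * (t ^ 4 / (real (Suc N))\<^sup>2 + t / Suc N) < e / 2"
      by (auto simp: eventually_sequentially)
    then show "\<exists>N0. \<forall>N\<ge>N0. norm (S N - h t) < e"
      using est by (intro exI[of _ N0]) (smt (verit) field_sum_of_halves real_norm_def)
  qed
  then show ?thesis unfolding eq by (rule tendsto_of_real)
qed

lemma binomial_approximant_holomorphic:
  assumes "0 < N"
  shows "binomial_approximant h N holomorphic_on {\<zeta>. 0 < Re \<zeta>}"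
proof -
  have nz: "2 * (1 + \<zeta> / N) \<noteq> 0" if "\<zeta> \<in> {\<zeta>. 0 < Re \<zeta>}" for \<zeta>
  proof -
    have "0 < Re (1 + \<zeta> / N)" using that assms by (simp add: add_pos_nonneg)
    then have "1 + \<zeta> / N \<noteq> 0" by force
    then show ?thesis by (metis mult_eq_0_iff zero_neq_numeral)
  qed
  have "(\<lambda>\<zeta>. (\<zeta> / N) / (2 * (1 + \<zeta> / N))) holomorphic_on {\<zeta>. 0 < Re \<zeta>}"
    by (intro holomorphic_on_divide holomorphic_on_mult holomorphic_on_add holomorphic_on_const
        holomorphic_on_ident nz) (use assms in auto)
  then show ?thesis unfolding binomial_approximant_def binomial_mean_def
    by (intro holomorphic_on_sum holomorphic_on_mult holomorphic_on_power holomorphic_on_diff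
        holomorphic_on_const)
qed

text \<open>The radius \<open>r\<close> is chosen such that discs of radius \<open>r\<close> around real points beyond \<open>a\<close> stay in the sector.
  Cauchy's inequalities on these discs bound the first two derivatives.\<close>
lemma holomorphic_sector_taylor:
  fixes F :: "complex \<Rightarrow> complex"
  assumes holo: "F holomorphic_on {\<zeta>. 0 < Re \<zeta>}" and \<kappa>: "0 < \<kappa>"
    and bound: "\<And>\<zeta>. 0 \<le> Re \<zeta> \<Longrightarrow> \<bar>Im \<zeta>\<bar> \<le> \<kappa> * Re \<zeta> \<Longrightarrow> cmod (F \<zeta>) \<le> M"
    and a: "0 < a" "a \<le> x" "a \<le> y"
  defines "r \<equiv> \<kappa> / (1 + \<kappa>) * a"
  shows "cmod (F (of_real y) - F (of_real x) - (of_real y - of_real x) * deriv F (of_real x))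
      \<le> 2 * M / r\<^sup>2 * (y - x)\<^sup>2"
    and "cmod (deriv F (of_real x)) \<le> M / r"
proof -
  have r: "0 < r" "r = \<kappa> * (a - r)" "r < a"
    using \<kappa> a by (auto simp: r_def field_simps)
  have sub: "0 < Re \<zeta> \<and> \<bar>Im \<zeta>\<bar> \<le> \<kappa> * Re \<zeta>" if "cmod (of_real w - \<zeta>) \<le> r" "a \<le> w" for \<zeta> w
  proof -
    have "\<bar>w - Re \<zeta>\<bar> \<le> r" "\<bar>Im \<zeta>\<bar> \<le> r"
      using abs_Re_le_cmod[of "of_real w - \<zeta>"] abs_Im_le_cmod[of "of_real w - \<zeta>"] that(1) by auto
    then have "a - r \<le> Re \<zeta>" "\<bar>Im \<zeta>\<bar> \<le> \<kappa> * (a - r)" using that(2) r(2) by auto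
    moreover have "\<kappa> * (a - r) \<le> \<kappa> * Re \<zeta>" using calculation(1) \<kappa> by simp
    ultimately show ?thesis using r(3) by linarith
  qed
  have deriv_bound: "cmod ((deriv ^^ k) F (of_real w)) \<le> fact k * M / r ^ k" if "a \<le> w" for w k
  proof (rule Cauchy_inequality[OF _ _ r(1)])
    show "F holomorphic_on ball (of_real w) r"
      by (rule holomorphic_on_subset[OF holo]) (use sub[OF _ that] in \<open>auto simp: dist_norm\<close>)
    show "continuous_on (cball (of_real w) r) F"
      by (rule holomorphic_on_imp_continuous_on[OF holomorphic_on_subset[OF holo]])
        (use sub[OF _ that] in \<open>auto simp: dist_norm\<close>)
    show "cmod (F \<zeta>) \<le> M" if "cmod (of_real w - \<zeta>) = r" for \<zeta>
      using sub[of w \<zeta>] that \<open>a \<le> w\<close> by (intro bound) auto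
  qed
  show "cmod (deriv F (of_real x)) \<le> M / r" using deriv_bound[OF a(2), of 1] by simp
  have opn: "open {\<zeta>. 0 < Re \<zeta>}" by (rule open_halfspace_Re_gt)
  have in_seg: "\<exists>w\<ge>a. z = of_real w" if "z \<in> closed_segment (of_real x) (of_real y)" for z :: complex
    using that a unfolding closed_segment_of_real by (auto simp: closed_segment_eq_real_ivl split: if_splits)
  have "cmod ((deriv ^^ 0) F (of_real y)
      - (\<Sum>i\<le>1. (deriv ^^ i) F (of_real x) * (of_real y - of_real x) ^ i / fact i))
      \<le> 2 * M / r\<^sup>2 * cmod (of_real y - of_real x) ^ Suc 1 / fact 1"
  proof (rule complex_Taylor[where S="closed_segment (of_real x) (of_real y)" and f="\<lambda>i. (deriv ^^ i) F"])
    fix i z assume z: "z \<in> closed_segment (complex_of_real x) (of_real y)"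
    then obtain w where w: "a \<le> w" "z = of_real w" using in_seg by blast
    have "(deriv ^^ i) F holomorphic_on {\<zeta>. 0 < Re \<zeta>}" by (rule holomorphic_higher_deriv[OF holo opn])
    from holomorphic_derivI[OF this opn]
    show "((deriv ^^ i) F has_field_derivative (deriv ^^ Suc i) F z)
        (at z within closed_segment (of_real x) (of_real y))" using w a by simp
  next
    fix z assume "z \<in> closed_segment (complex_of_real x) (of_real y)"
    then obtain w where "a \<le> w" "z = of_real w" using in_seg by blast
    then show "cmod ((deriv ^^ Suc 1) F z) \<le> 2 * M / r\<^sup>2"
      using deriv_bound[of w 2] by (simp add: numeral_2_eq_2)
  qed auto
  also have "cmod (of_real y - of_real x) ^ Suc 1 = (y - x)\<^sup>2"
    by (metis Suc_1 norm_of_real of_real_diff power2_abs)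
  finally show "cmod (F (of_real y) - F (of_real x) - (of_real y - of_real x) * deriv F (of_real x))
      \<le> 2 * M / r\<^sup>2 * (y - x)\<^sup>2"
    by (simp add: algebra_simps)
qed

text \<open>The Taylor bounds are uniform in \<open>N\<close>, so a limit point \<open>l\<close> of the bounded derivatives at \<open>x\<close> serves as
  the derivative of the limit \<open>h\<close>, with the same quadratic error.\<close>
lemma sector_bound_imp_differentiable:
  assumes M: "\<And>t. 0 \<le> t \<Longrightarrow> \<bar>h t\<bar> \<le> M" and cont: "\<And>t. 0 < t \<Longrightarrow> isCont h t"
    and \<kappa>: "0 < \<kappa>"
    and bound: "\<And>N \<zeta>. 0 \<le> Re \<zeta> \<Longrightarrow> \<bar>Im \<zeta>\<bar> \<le> \<kappa> * Re \<zeta> \<Longrightarrow> cmod (binomial_approximant h (Suc N) \<zeta>) \<le> M"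
    and a: "0 < a" "a \<le> x"
  shows "\<exists>l. \<forall>y\<ge>a. \<bar>h y - h x - (y - x) * l\<bar> \<le> 2 * M / (\<kappa> / (1 + \<kappa>) * a)\<^sup>2 * (y - x)\<^sup>2"
proof -
  define r where "r = \<kappa> / (1 + \<kappa>) * a"
  define D where "D = (\<lambda>N. deriv (binomial_approximant h (Suc N)) (of_real x))"
  note taylor = holomorphic_sector_taylor[OF binomial_approximant_holomorphic \<kappa> bound a(1), folded r_def]
  have "bounded (range D)"
    using taylor(2)[OF _ _ _ a(2) a(2)] by (auto simp: bounded_iff D_def)
  then obtain L s where s: "strict_mono s" "(D \<circ> s) \<longlonglongrightarrow> L"
    using bounded_imp_convergent_subsequence by blast
  have "\<bar>h y - h x - (y - x) * Re L\<bar> \<le> 2 * M / r\<^sup>2 * (y - x)\<^sup>2" if y: "a \<le> y" for y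
  proof -
    have conv: "(\<lambda>N. binomial_approximant h (Suc (s N)) (of_real w)) \<longlonglongrightarrow> of_real (h w)" if "a \<le> w" for w
      using LIMSEQ_subseq_LIMSEQ[OF binomial_approximant_tendsto[OF M _ cont] s(1), of w] a(1) that by (auto simp: o_def)
    have "(\<lambda>N. cmod (binomial_approximant h (Suc (s N)) (of_real y) - binomial_approximant h (Suc (s N)) (of_real x) - (of_real y - of_real x) * (D \<circ> s) N))
        \<longlonglongrightarrow> cmod (of_real (h y) - of_real (h x) - (of_real y - of_real x) * L)"
      by (intro tendsto_intros conv y a(2) s(2))
    then have "cmod (of_real (h y) - of_real (h x) - (of_real y - of_real x) * L) \<le> 2 * M / r\<^sup>2 * (y - x)\<^sup>2"
      by (rule LIMSEQ_le_const2) (use taylor(1)[OF _ _ _ a(2) y] in \<open>auto simp: D_def\<close>)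
    then show ?thesis
      using order_trans[OF abs_Re_le_cmod[of "of_real (h y) - of_real (h x) - (of_real y - of_real x) * L"]] by simp
  qed
  then show ?thesis unfolding r_def by blast
qed

section \<open>Orbits of a symmetric Markovian semigroup\<close>
locale symmetric_markov_semigroup =
  fixes m :: "'a measure" and p :: real and P :: "real \<Rightarrow> ('a \<Rightarrow> real) \<Rightarrow> 'a \<Rightarrow> real"
  assumes submarkov: "0 \<le> t \<Longrightarrow> symmetric_submarkov m p (P t)"
    and zero: "f \<in> Lp m p \<Longrightarrow> AE x in m. P 0 f x = f x"
    and add: "0 \<le> s \<Longrightarrow> 0 \<le> t \<Longrightarrow> f \<in> Lp m p \<Longrightarrow> AE x in m. P (s + t) f x = P s (P t f) x"
    and continuous: "f \<in> Lp m p \<Longrightarrow> ((\<lambda>t. \<integral>x. \<bar>P t f x - f x\<bar> powr p \<partial>m) \<longlongrightarrow> 0) (at_right 0)"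
begin

lemma p: "1 < p"
  using submarkov[of 0] by (simp add: symmetric_submarkov_def Lp_contraction_def)

lemma Lp_contraction: "0 \<le> t \<Longrightarrow> Lp_contraction m p (P t)"
  using submarkov by (simp add: symmetric_submarkov_def)

lemmas maps_Lp = Lp_contraction.maps_Lp[OF Lp_contraction]
lemmas linear = Lp_contraction.linear[OF Lp_contraction]
lemmas contraction = Lp_contraction.contraction[OF Lp_contraction]

abbreviation "q \<equiv> p / (p - 1)"

lemma pairing_cong_AE:
  assumes "u \<in> Lp m p" "v \<in> Lp m p" "g \<in> Lp m q" "AE x in m. u x = v x"
  shows "pairing m u g = pairing m v g"
proof -
  note [measurable] = assms(1,2)[THEN LpD(1)] LpD(1)[OF assms(3)]
  show ?thesis unfolding pairing_def by (rule integral_cong_AE) (use assms(4) in auto)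
qed

lemma pairing_lincomb:
  assumes "u \<in> Lp m p" "v \<in> Lp m p" "g \<in> Lp m q"
  shows "pairing m (\<lambda>x. a * u x + b * v x) g = a * pairing m u g + b * pairing m v g"
  unfolding pairing_def using integrable_Lp_mult[OF p assms(1,3)] integrable_Lp_mult[OF p assms(2,3)]
  by (simp add: distrib_right mult.assoc)

lemma pairing_P_lincomb:
  assumes "0 \<le> t" "u \<in> Lp m p" "v \<in> Lp m p" "g \<in> Lp m q"
  shows "pairing m (P t (\<lambda>x. a * u x + b * v x)) g = a * pairing m (P t u) g + b * pairing m (P t v) g"
proof -
  have "pairing m (P t (\<lambda>x. a * u x + b * v x)) g = pairing m (\<lambda>x. a * P t u x + b * P t v x) g"
    using assms p by (intro pairing_cong_AE linear maps_Lp Lp_lincomb) auto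
  then show ?thesis using pairing_lincomb maps_Lp assms by simp
qed

lemma cmod_pairing_le:
  fixes u :: "'a \<Rightarrow> complex"
  assumes u: "(\<lambda>x. Re (u x)) \<in> Lp m p" "(\<lambda>x. Im (u x)) \<in> Lp m p" and g: "g \<in> Lp m q"
  shows "cmod (Complex (pairing m (\<lambda>x. Re (u x)) g) (pairing m (\<lambda>x. Im (u x)) g))
    \<le> (\<integral>x. cmod (u x) powr p \<partial>m) / p + (1 - 1 / p) * (\<integral>x. \<bar>g x\<bar> powr q \<partial>m)"
proof -
  have u': "u \<in> borel_measurable m" "integrable m (\<lambda>x. cmod (u x) powr p)"
    using complex_Lp_iff[of p u m] u p by auto
  note [measurable] = u'(1) LpD(1)[OF g]
  have dom: "integrable m (\<lambda>x. cmod (u x) powr p / p + (1 - 1 / p) * \<bar>g x\<bar> powr q)"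
    using u'(2) LpD(2)[OF g] by auto
  have le: "cmod (u x * of_real (g x)) \<le> cmod (u x) powr p / p + (1 - 1 / p) * \<bar>g x\<bar> powr q" for x
    using abs_mult_le_young[OF p, of "cmod (u x)" "g x"] by (simp add: norm_mult abs_mult)
  have int: "integrable m (\<lambda>x. u x * of_real (g x))"
    by (rule Bochner_Integration.integrable_bound[OF dom]) (measurable, intro AE_I2, metis le abs_ge_self order_trans real_norm_def)
  have "Complex (pairing m (\<lambda>x. Re (u x)) g) (pairing m (\<lambda>x. Im (u x)) g) = (\<integral>x. u x * of_real (g x) \<partial>m)"
    using integral_Re[OF int] integral_Im[OF int] by (simp add: complex_eq_iff pairing_def)
  also have "cmod \<dots> \<le> (\<integral>x. cmod (u x) powr p / p + (1 - 1 / p) * \<bar>g x\<bar> powr q \<partial>m)"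
    by (rule order_trans[OF integral_norm_bound integral_mono_AE])
      (use int dom le in auto)
  also have "\<dots> = (\<integral>x. cmod (u x) powr p \<partial>m) / p + (1 - 1 / p) * (\<integral>x. \<bar>g x\<bar> powr q \<partial>m)"
    using u'(2) LpD(2)[OF g] by simp
  finally show ?thesis .
qed

text \<open>Each step replaces \<open>u\<close> by \<open>(1 - \<eta>) u + \<eta> P s u\<close> without increasing its norm, and by Pascal's rule this
  replacement turns the binomial mean of order \<open>n + 1\<close> for \<open>u\<close> into the one of order \<open>n\<close>. Pairing
  with \<open>g\<close> from the start reduces an operator identity to one between numbers.\<close>
lemma binomial_mean_bound_complex:
  fixes u :: "'a \<Rightarrow> complex"
  assumes s: "0 \<le> s" and g: "g \<in> Lp m q"
    and two_point: "\<And>a b. cmod ((1 - \<eta>) * a + \<eta> * b) powr p + cmod ((1 - \<eta>) * b + \<eta> * a) powr p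
      \<le> cmod a powr p + cmod b powr p"
    and u: "(\<lambda>x. Re (u x)) \<in> Lp m p" "(\<lambda>x. Im (u x)) \<in> Lp m p"
  shows "cmod (binomial_mean \<eta> n (\<lambda>k. Complex (pairing m (P (k * s) (\<lambda>x. Re (u x))) g)
      (pairing m (P (k * s) (\<lambda>x. Im (u x))) g)))
    \<le> (\<integral>x. cmod (u x) powr p \<partial>m) / p + (1 - 1 / p) * (\<integral>x. \<bar>g x\<bar> powr q \<partial>m)"
  using u
proof (induction n arbitrary: u)
  case 0
  have "pairing m (P 0 f) g = pairing m f g" if "f \<in> Lp m p" for f
    by (rule pairing_cong_AE[OF maps_Lp[OF order_refl that] that g zero[OF that]])
  then show ?case using cmod_pairing_le[OF 0 g] 0 by (simp add: binomial_mean_def)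
next
  case (Suc n)
  define v where "v = (\<lambda>x. (1 - \<eta>) * u x + \<eta> * complexify (P s) u x)"
  have v: "(\<lambda>x. Re (v x)) \<in> Lp m p" "(\<lambda>x. Im (v x)) \<in> Lp m p"
    "(\<integral>x. cmod (v x) powr p \<partial>m) \<le> (\<integral>x. cmod (u x) powr p \<partial>m)"
    using symmetric_submarkov.two_point_step[OF submarkov[OF s] Suc.prems two_point] by (auto simp: v_def)
  have Ps: "P s (\<lambda>x. Re (u x)) \<in> Lp m p" "P s (\<lambda>x. Im (u x)) \<in> Lp m p"
    using maps_Lp s Suc.prems by auto
  have next_power: "pairing m (P (k * s) (P s f)) g = pairing m (P (Suc k * s) f) g" if f: "f \<in> Lp m p" for f k
  proof (rule pairing_cong_AE[OF _ _ g])
    have "AE x in m. P (k * s + s) f x = P (k * s) (P s f) x" by (rule add) (use s f in auto)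
    moreover have "real (Suc k) * s = k * s + s" by (simp add: algebra_simps)
    ultimately show "AE x in m. P (k * s) (P s f) x = P (Suc k * s) f x" by auto
  qed (use maps_Lp s f in auto)
  have step: "Complex (pairing m (P (k * s) (\<lambda>x. Re (v x))) g) (pairing m (P (k * s) (\<lambda>x. Im (v x))) g)
      = (1 - \<eta>) * Complex (pairing m (P (k * s) (\<lambda>x. Re (u x))) g) (pairing m (P (k * s) (\<lambda>x. Im (u x))) g)
        + \<eta> * Complex (pairing m (P (Suc k * s) (\<lambda>x. Re (u x))) g) (pairing m (P (Suc k * s) (\<lambda>x. Im (u x))) g)"
    for k
  proof -
    let ?D = "\<lambda>f. pairing m (P (k * s) f) g"
    have D: "?D (\<lambda>x. 1 * (a * f1 x + b * f2 x) + 1 * (c * f3 x + d * f4 x))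
        = a * ?D f1 + b * ?D f2 + (c * ?D f3 + d * ?D f4)"
      if "f1 \<in> Lp m p" "f2 \<in> Lp m p" "f3 \<in> Lp m p" "f4 \<in> Lp m p" for f1 f2 f3 f4 a b c d
    proof -
      have 1: "(\<lambda>x. a * f1 x + b * f2 x) \<in> Lp m p" "(\<lambda>x. c * f3 x + d * f4 x) \<in> Lp m p"
        using that p by (auto intro!: Lp_lincomb)
      have ks: "0 \<le> k * s" using s by simp
      show ?thesis
        unfolding pairing_P_lincomb[OF ks 1 g] pairing_P_lincomb[OF ks that(1,2) g] pairing_P_lincomb[OF ks that(3,4) g]
        by simp
    qed
    have "(\<lambda>x. Re (v x)) = (\<lambda>x. 1 * (Re (1 - \<eta>) * Re (u x) + (- Im (1 - \<eta>)) * Im (u x))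
        + 1 * (Re \<eta> * P s (\<lambda>x. Re (u x)) x + (- Im \<eta>) * P s (\<lambda>x. Im (u x)) x))"
      by (simp add: v_def complexify_def)
    then have re: "?D (\<lambda>x. Re (v x)) = Re (1 - \<eta>) * ?D (\<lambda>x. Re (u x)) + (- Im (1 - \<eta>)) * ?D (\<lambda>x. Im (u x))
        + (Re \<eta> * ?D (P s (\<lambda>x. Re (u x))) + (- Im \<eta>) * ?D (P s (\<lambda>x. Im (u x))))"
      using D[OF Suc.prems Ps] by presburger
    have "(\<lambda>x. Im (v x)) = (\<lambda>x. 1 * (Re (1 - \<eta>) * Im (u x) + Im (1 - \<eta>) * Re (u x))
        + 1 * (Re \<eta> * P s (\<lambda>x. Im (u x)) x + Im \<eta> * P s (\<lambda>x. Re (u x)) x))"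
      by (simp add: v_def complexify_def)
    then have im: "?D (\<lambda>x. Im (v x)) = Re (1 - \<eta>) * ?D (\<lambda>x. Im (u x)) + Im (1 - \<eta>) * ?D (\<lambda>x. Re (u x))
        + (Re \<eta> * ?D (P s (\<lambda>x. Im (u x))) + Im \<eta> * ?D (P s (\<lambda>x. Re (u x))))"
      using D[OF Suc.prems(2,1) Ps(2,1)] by presburger
    show ?thesis
      unfolding re im next_power[OF Suc.prems(1)] next_power[OF Suc.prems(2)]
      by (simp add: complex_eq_iff del: of_nat_Suc)
  qed
  show ?case
    unfolding binomial_mean_Suc step[symmetric] using Suc.IH[OF v(1,2)] v(3) p
    by (smt (verit) divide_right_mono)
qed

lemma binomial_mean_bound:
  assumes s: "0 \<le> s" and f: "f \<in> Lp m p" and g: "g \<in> Lp m q"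
    and z: "0 \<le> Re z" "\<bar>Im z\<bar> \<le> sector_slope p * Re z"
  shows "cmod (binomial_mean (z / (2 * (1 + z))) n (\<lambda>k. of_real (pairing m (P (k * s) f) g)))
    \<le> (\<integral>x. \<bar>f x\<bar> powr p \<partial>m) / p + (1 - 1 / p) * (\<integral>x. \<bar>g x\<bar> powr q \<partial>m)"
proof -
  have 0: "pairing m (P (k * s) (\<lambda>x. 0)) g = 0" for k :: nat
    using pairing_P_lincomb[OF _ Lp_zero Lp_zero g, of "k * s" 0 0] s by simp
  show ?thesis
    using binomial_mean_bound_complex[OF s g two_point_contraction[OF p z refl], of "\<lambda>x. of_real (f x)" n] f
    by (simp add: Lp_zero 0 Complex_eq)
qed

lemma pairing_abs_le:
  assumes "u \<in> Lp m p" "g \<in> Lp m q"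
  shows "\<bar>pairing m u g\<bar> \<le> (\<integral>x. \<bar>u x\<bar> powr p \<partial>m) / p + (1 - 1 / p) * (\<integral>x. \<bar>g x\<bar> powr q \<partial>m)"
  using cmod_pairing_le[of "\<lambda>x. of_real (u x)" g] assms
  by (simp add: Lp_zero pairing_def cmod_def)

text \<open>Young's inequality applied to \<open>u / \<delta>\<close> and \<open>\<delta> g\<close>: a small \<open>\<delta>\<close> makes the contribution of \<open>g\<close> small,
  and then the one of \<open>u\<close> tends to zero.\<close>
lemma pairing_tendsto_0:
  assumes u: "\<And>i. i \<in> I \<Longrightarrow> u i \<in> Lp m p" and g: "g \<in> Lp m q" and I: "eventually (\<lambda>i. i \<in> I) F"
    and lim: "((\<lambda>i. \<integral>x. \<bar>u i x\<bar> powr p \<partial>m) \<longlongrightarrow> 0) F"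
  shows "((\<lambda>i. pairing m (u i) g) \<longlongrightarrow> 0) F"
proof (rule tendstoI)
  fix e :: real assume e: "0 < e"
  define G where "G = (\<integral>x. \<bar>g x\<bar> powr q \<partial>m)"
  have "0 \<le> G" by (simp add: G_def integral_nonneg_AE)
  obtain \<delta> where \<delta>: "0 < \<delta>" "\<delta> powr q * G \<le> e / 2"
  proof
    define \<delta> where "\<delta> = (e / (2 * (G + 1))) powr (1 / q)"
    show "0 < \<delta>" using e \<open>0 \<le> G\<close> by (simp add: \<delta>_def)
    have "\<delta> powr q = e / (2 * (G + 1))" using e \<open>0 \<le> G\<close> p by (simp add: \<delta>_def powr_powr)
    moreover have "e / (2 * (G + 1)) * G \<le> e / (2 * (G + 1)) * (G + 1)"
      using e \<open>0 \<le> G\<close> by (intro mult_left_mono) auto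
    moreover have "e / (2 * (G + 1)) * (G + 1) = e / 2" using \<open>0 \<le> G\<close> by (simp add: field_simps)
    ultimately show "\<delta> powr q * G \<le> e / 2" by metis
  qed
  have le: "\<bar>pairing m (u i) g\<bar> \<le> (1 / \<delta>) powr p * (\<integral>x. \<bar>u i x\<bar> powr p \<partial>m) + e / 2" if i: "i \<in> I" for i
  proof -
    have s: "(\<lambda>x. (1 / \<delta>) * u i x) \<in> Lp m p" "(\<lambda>x. \<delta> * g x) \<in> Lp m q"
      using Lp_lincomb[OF _ u[OF i] Lp_zero, of "1 / \<delta>" 0] Lp_lincomb[OF _ g Lp_zero, of \<delta> 0] p by auto
    have "pairing m (u i) g = pairing m (\<lambda>x. (1 / \<delta>) * u i x) (\<lambda>x. \<delta> * g x)"
      using \<delta> by (simp add: pairing_def)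
    also have "\<bar>\<dots>\<bar> \<le> (\<integral>x. \<bar>(1 / \<delta>) * u i x\<bar> powr p \<partial>m) / p + (1 - 1 / p) * (\<integral>x. \<bar>\<delta> * g x\<bar> powr q \<partial>m)"
      by (rule pairing_abs_le[OF s])
    also have "(\<integral>x. \<bar>(1 / \<delta>) * u i x\<bar> powr p \<partial>m) = (1 / \<delta>) powr p * (\<integral>x. \<bar>u i x\<bar> powr p \<partial>m)"
      using \<delta> by (simp add: abs_mult powr_mult powr_divide)
    also have "(\<integral>x. \<bar>\<delta> * g x\<bar> powr q \<partial>m) = \<delta> powr q * G"
      using \<delta> by (simp add: abs_mult powr_mult G_def)
    also have "(1 / \<delta>) powr p * (\<integral>x. \<bar>u i x\<bar> powr p \<partial>m) / p + (1 - 1 / p) * (\<delta> powr q * G)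
        \<le> (1 / \<delta>) powr p * (\<integral>x. \<bar>u i x\<bar> powr p \<partial>m) + e / 2"
    proof (rule add_mono)
      have "0 \<le> (1 / \<delta>) powr p * (\<integral>x. \<bar>u i x\<bar> powr p \<partial>m)" by (simp add: integral_nonneg_AE)
      then show "(1 / \<delta>) powr p * (\<integral>x. \<bar>u i x\<bar> powr p \<partial>m) / p \<le> (1 / \<delta>) powr p * (\<integral>x. \<bar>u i x\<bar> powr p \<partial>m)"
        using p divide_left_mono[of 1 p "(1 / \<delta>) powr p * (\<integral>x. \<bar>u i x\<bar> powr p \<partial>m)"] by simp
      show "(1 - 1 / p) * (\<delta> powr q * G) \<le> e / 2"
        by (rule order_trans[OF mult_left_le_one_le \<delta>(2)]) (use p \<open>0 \<le> G\<close> in auto)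
    qed
    finally show ?thesis .
  qed
  have "((\<lambda>i. (1 / \<delta>) powr p * (\<integral>x. \<bar>u i x\<bar> powr p \<partial>m)) \<longlongrightarrow> (1 / \<delta>) powr p * 0) F"
    by (intro tendsto_intros lim)
  then have "eventually (\<lambda>i. (1 / \<delta>) powr p * (\<integral>x. \<bar>u i x\<bar> powr p \<partial>m) < e / 2) F"
    by (rule order_tendstoD(2)) (use e in simp)
  then show "eventually (\<lambda>i. dist (pairing m (u i) g) 0 < e) F"
    using I by eventually_elim (use le in \<open>fastforce simp: dist_real_def\<close>)
qed

lemma pairing_orbit_isCont:
  assumes f: "f \<in> Lp m p" and g: "g \<in> Lp m q" and t: "0 < t"
  shows "isCont (\<lambda>r. pairing m (P r f) g) t"
proof -
  let ?h = "\<lambda>r. pairing m (P r f) g"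
  define d where "d = (\<lambda>r s. pairing m (\<lambda>x. P r f x - P s f x) g)"
  have diff: "d r s = ?h r - ?h s" if "0 \<le> r" "0 \<le> s" for r s
    using pairing_lincomb[OF maps_Lp[OF that(1) f] maps_Lp[OF that(2) f] g, of 1 "-1"] by (simp add: d_def)
  have norm_le: "(\<integral>x. \<bar>P (r + s) f x - P r f x\<bar> powr p \<partial>m) \<le> (\<integral>x. \<bar>P s f x - f x\<bar> powr p \<partial>m)"
    if "0 \<le> r" "0 \<le> s" for r s
  proof -
    have Lp: "P s f \<in> Lp m p" "P (r + s) f \<in> Lp m p" "P r f \<in> Lp m p" "P r (P s f) \<in> Lp m p"
      using that maps_Lp f by auto
    note [measurable] = Lp[THEN LpD(1)]
    have "(\<integral>x. \<bar>P (r + s) f x - P r f x\<bar> powr p \<partial>m) = (\<integral>x. \<bar>P r (P s f) x - P r f x\<bar> powr p \<partial>m)"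
      by (rule integral_cong_AE) (use add[OF that f] in auto)
    also have "\<dots> \<le> (\<integral>x. \<bar>P s f x - f x\<bar> powr p \<partial>m)"
      by (rule Lp_contraction.contraction_diff[OF Lp_contraction[OF that(1)] Lp(1) f])
    finally show ?thesis .
  qed
  have small: "((\<lambda>s. d (a s + s) (a s)) \<longlongrightarrow> 0) (at_right 0)"
    if a: "eventually (\<lambda>s. 0 \<le> a s) (at_right 0)" for a
  proof -
    have ev: "eventually (\<lambda>s. s \<in> {s. 0 \<le> s \<and> 0 \<le> a s}) (at_right 0)"
      using a eventually_at_right_less[of 0] by eventually_elim auto
    show ?thesis unfolding d_def
    proof (rule pairing_tendsto_0[OF _ g ev])
      show "((\<lambda>s. \<integral>x. \<bar>P (a s + s) f x - P (a s) f x\<bar> powr p \<partial>m) \<longlongrightarrow> 0) (at_right 0)"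
        by (rule Lim_null_comparison[OF _ continuous[OF f]])
          (use ev in \<open>eventually_elim, use norm_le in \<open>auto simp: integral_nonneg_AE\<close>\<close>)
    qed (use p in \<open>auto intro!: Lp_diff maps_Lp f\<close>)
  qed
  have "((\<lambda>s. d (t + s) t) \<longlongrightarrow> 0) (at_right 0)" using small[of "\<lambda>_. t"] t by simp
  moreover have "\<forall>\<^sub>F s in at_right 0. d (t + s) t = ?h (t + s) - ?h t"
    using eventually_at_right_less[of 0] by eventually_elim (rule diff, use t in auto)
  ultimately have "((\<lambda>s. ?h (t + s) - ?h t) \<longlongrightarrow> 0) (at_right 0)"
    by (rule Lim_transform_eventually)
  then have right: "((\<lambda>s. ?h (t + s)) \<longlongrightarrow> ?h t) (at_right 0)" by (rule LIM_zero_cancel)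
  have ev: "\<forall>\<^sub>F s in at_right 0. 0 \<le> t - s"
    using t by (auto intro!: eventually_at_rightI[of 0 t])
  have "((\<lambda>s. - d (t - s + s) (t - s)) \<longlongrightarrow> - 0) (at_right 0)"
    by (intro tendsto_minus small ev)
  moreover have "\<forall>\<^sub>F s in at_right 0. - d (t - s + s) (t - s) = ?h (t - s) - ?h t"
    using ev
  proof eventually_elim
    case (elim s)
    then show ?case using diff[of "t - s + s" "t - s"] t by simp
  qed
  ultimately have "((\<lambda>s. ?h (t - s) - ?h t) \<longlongrightarrow> - 0) (at_right 0)"
    by (rule Lim_transform_eventually)
  then have "((\<lambda>s. ?h (t - s) - ?h t) \<longlongrightarrow> 0) (at_right 0)" unfolding minus_zero .
  then have left: "((\<lambda>s. ?h (t - s)) \<longlongrightarrow> ?h t) (at_right 0)" by (rule LIM_zero_cancel)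
  have R: "(?h \<longlongrightarrow> ?h t) (at_right t)"
    unfolding filterlim_at_right_to_0[of ?h _ t] using right by (simp only: add.commute)
  have L: "(?h \<longlongrightarrow> ?h t) (at_left t)"
    unfolding filterlim_at_left_to_right filterlim_at_right_to_0[of _ _ "- t"] using left by simp
  show ?thesis unfolding isCont_def by (rule filterlim_split_at[OF L R])
qed

text \<open>The form in which the analyticity of the semigroup on \<open>L\<^sup>p\<close> is needed: the function
  \<open>r \<mapsto> \<langle>P r f, g\<rangle>\<close> is differentiable for positive times, and the quadratic error depends on \<open>f\<close> and
  \<open>g\<close> only through \<open>M\<close> for times beyond a fixed \<open>a > 0\<close>. This uniformity allows \<open>g\<close> to move with \<open>t\<close> later on.\<close>
lemma pairing_orbit_differentiable:
  assumes f: "f \<in> Lp m p" and g: "g \<in> Lp m q"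
    and M: "(\<integral>x. \<bar>f x\<bar> powr p \<partial>m) / p + (1 - 1 / p) * (\<integral>x. \<bar>g x\<bar> powr q \<partial>m) \<le> M"
    and a: "0 < a" "a \<le> t"
  shows "\<exists>l. \<forall>r\<ge>a. \<bar>pairing m (P r f) g - pairing m (P t f) g - (r - t) * l\<bar>
    \<le> 2 * M / (sector_slope p / (1 + sector_slope p) * a)\<^sup>2 * (r - t)\<^sup>2"
proof (rule sector_bound_imp_differentiable[where h="\<lambda>r. pairing m (P r f) g"])
  show "\<bar>pairing m (P r f) g\<bar> \<le> M" if "0 \<le> r" for r
  proof -
    have "\<bar>pairing m (P r f) g\<bar> \<le> (\<integral>x. \<bar>P r f x\<bar> powr p \<partial>m) / p + (1 - 1 / p) * (\<integral>x. \<bar>g x\<bar> powr q \<partial>m)"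
      by (rule pairing_abs_le[OF maps_Lp[OF that f] g])
    also have "\<dots> \<le> M" using contraction[OF that f] M p
      by (smt (verit) divide_right_mono)
    finally show ?thesis .
  qed
  show "cmod (binomial_approximant (\<lambda>r. pairing m (P r f) g) (Suc N) \<zeta>) \<le> M"
    if \<zeta>: "0 \<le> Re \<zeta>" "\<bar>Im \<zeta>\<bar> \<le> sector_slope p * Re \<zeta>" for N \<zeta>
  proof -
    have z: "0 \<le> Re (\<zeta> / Suc N)" "\<bar>Im (\<zeta> / Suc N)\<bar> \<le> sector_slope p * Re (\<zeta> / Suc N)"
      using \<zeta> by (auto simp: divide_right_mono simp del: of_nat_Suc)
    show ?thesis
      using binomial_mean_bound[OF _ f g z, of "1 / Suc N" "2 * (Suc N)\<^sup>2"] M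
      unfolding binomial_approximant_def by simp
  qed
qed (use pairing_orbit_isCont[OF f g] sector_slope_pos[OF p] a in auto)

end

section \<open>The energy along an orbit\<close>
text \<open>A selection \<open>s\<close> of subgradients of a convex function is monotone, hence integrable, but it may jump, so
  the fundamental theorem of calculus does not apply directly. On \<open>[x, y]\<close> the integral of \<open>s\<close> and the increment of
  \<open>\<psi>\<close> both lie between \<open>(y - x) s x\<close> and \<open>(y - x) s y\<close>; over a partition into \<open>n + 1\<close> equal
  pieces these errors telescope to \<open>(b - a) (s b - s a) / (n + 1)\<close>.\<close>
lemma subgradient_has_integral:
  fixes \<psi> s :: "real \<Rightarrow> real"
  assumes ab: "a \<le> b"
    and sub: "\<And>x y. x \<in> {a..b} \<Longrightarrow> y \<in> {a..b} \<Longrightarrow> \<psi> x + (y - x) * s x \<le> \<psi> y"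
  shows "(s has_integral \<psi> b - \<psi> a) {a..b}"
proof -
  have mono: "s x \<le> s y" if "x \<in> {a..b}" "y \<in> {a..b}" "x \<le> y" for x y
  proof (cases "x = y")
    case False
    have "(y - x) * s x \<le> (y - x) * s y"
      using sub[OF that(1,2)] sub[OF that(2,1)] by (simp add: algebra_simps)
    then show ?thesis using False that(3) by simp
  qed simp
  have int: "s integrable_on {x..y}" if "a \<le> x" "y \<le> b" for x y
    by (rule integrable_on_mono_on, rule mono_onI, rule mono) (use that in auto)
  have piece: "\<bar>integral {x..y} s - (\<psi> y - \<psi> x)\<bar> \<le> (y - x) * (s y - s x)"
    if "a \<le> x" "x \<le> y" "y \<le> b" for x y
  proof -
    have "integral {x..y} (\<lambda>_. s x) \<le> integral {x..y} s" "integral {x..y} s \<le> integral {x..y} (\<lambda>_. s y)"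
      by (rule integral_le[OF _ int] integral_le[OF int]; use that mono in auto)+
    then have "(y - x) * s x \<le> integral {x..y} s" "integral {x..y} s \<le> (y - x) * s y"
      using that by simp_all
    moreover have "(y - x) * s x \<le> \<psi> y - \<psi> x" "\<psi> y - \<psi> x \<le> (y - x) * s y"
      using sub[of x y] sub[of y x] that by (auto simp: algebra_simps)
    ultimately show ?thesis unfolding right_diff_distrib by linarith
  qed
  have n: "\<bar>integral {a..b} s - (\<psi> b - \<psi> a)\<bar> \<le> (b - a) * (s b - s a) * (1 / Suc n)" for n
  proof -
    define d where "d = (b - a) / Suc n"
    have d: "0 \<le> d" "a + Suc n * d = b" using ab by (simp_all add: d_def del: of_nat_Suc)
    have "a + i * d \<le> b \<longrightarrow> \<bar>integral {a..a + i * d} s - (\<psi> (a + i * d) - \<psi> a)\<bar> \<le> d * (s (a + i * d) - s a)" for i :: nat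
    proof (induction i)
      case (Suc i)
      let ?x = "a + i * d" and ?y = "a + Suc i * d"
      show ?case
      proof
        assume y: "?y \<le> b"
        have xy: "a \<le> ?x" "?x \<le> ?y" "?y - ?x = d" using d(1) by (auto simp: algebra_simps)
        have "integral {a..?x} s + integral {?x..?y} s = integral {a..?y} s"
          by (rule Henstock_Kurzweil_Integration.integral_combine) (use xy y int in auto)
        moreover have "\<bar>integral {?x..?y} s - (\<psi> ?y - \<psi> ?x)\<bar> \<le> d * (s ?y - s ?x)"
          using piece[OF xy(1,2) y] unfolding xy(3) .
        moreover have "\<bar>integral {a..?x} s - (\<psi> ?x - \<psi> a)\<bar> \<le> d * (s ?x - s a)"
          using Suc.IH xy(2) y by linarith
        ultimately show "\<bar>integral {a..?y} s - (\<psi> ?y - \<psi> a)\<bar> \<le> d * (s ?y - s a)"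
          unfolding right_diff_distrib by linarith
      qed
    qed simp
    from this[of "Suc n"] show ?thesis unfolding d(2) by (simp add: d_def)
  qed
  have "(\<lambda>n. (b - a) * (s b - s a) * (1 / Suc n)) \<longlonglongrightarrow> (b - a) * (s b - s a) * 0"
    using LIMSEQ_inverse_real_of_nat by (intro tendsto_intros) (simp add: inverse_eq_divide)
  then have "\<bar>integral {a..b} s - (\<psi> b - \<psi> a)\<bar> \<le> (b - a) * (s b - s a) * 0"
    by (rule LIMSEQ_le_const) (use n in auto)
  then have "integral {a..b} s = \<psi> b - \<psi> a" by simp
  then show ?thesis using integrable_integral[OF int[OF order_refl order_refl]] by simp
qed

context symmetric_markov_semigroup
begin

text \<open>A bound, uniform for times beyond \<open>a\<close>, for the quadratic error of all the functions
  \<open>r \<mapsto> \<langle>P r f, g\<rangle>\<close> with \<open>\<integral>\<bar>g\<bar>\<^sup>q \<le> \<integral>\<bar>f\<bar>\<^sup>p\<close>.\<close>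
definition curvature :: "('a \<Rightarrow> real) \<Rightarrow> real \<Rightarrow> real" where
  "curvature f a = 2 * (\<integral>x. \<bar>f x\<bar> powr p \<partial>m) / (sector_slope p / (1 + sector_slope p) * a)\<^sup>2"

text \<open>Testing the orbit with \<open>g = (P t f)\<^sup>\<langle>\<^sup>p\<^sup>-\<^sup>1\<^sup>\<rangle>\<close> gives both claims. Since \<open>g\<close> is fixed, the limit defining
  the \<open>p\<close>-form at \<open>P t f\<close> is minus the derivative of \<open>r \<mapsto> \<langle>P r f, g\<rangle>\<close> at \<open>r = t\<close>. As \<open>p g\<close> is a subgradient
  of the \<open>p\<close>-th power of the norm at \<open>P t f\<close>, the \<open>p\<close>-form is \<open>- 1 / p\<close> times a subgradient of
  \<open>y \<mapsto> \<integral>\<bar>P y f\<bar>\<^sup>p\<close> at \<open>t\<close>, up to a quadratic error. This holds for \<open>y\<close> on both sides of \<open>t\<close>.\<close>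
lemma orbit_energy:
  assumes f: "f \<in> Lp m p" and a: "0 < a" "a \<le> t"
  defines "g \<equiv> \<lambda>x. signed_powr (P t f x) (p - 1)"
  shows "((\<lambda>s. approx_form m P s (P t f) g) \<longlongrightarrow> p_form m P p (P t f)) (at_right 0)"
    and "a \<le> y \<Longrightarrow> (\<integral>x. \<bar>P t f x\<bar> powr p \<partial>m) - p * (y - t) * p_form m P p (P t f)
      - p * curvature f a * (y - t)\<^sup>2 \<le> (\<integral>x. \<bar>P y f x\<bar> powr p \<partial>m)"
proof -
  have t: "0 < t" using a by simp
  have ut: "P t f \<in> Lp m p" using maps_Lp[OF _ f] t by simp
  have g: "g \<in> Lp m q" "\<And>x. \<bar>g x\<bar> powr q = \<bar>P t f x\<bar> powr p"
    using signed_powr_Lp[OF p ut] by (auto simp: g_def)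
  let ?h = "\<lambda>r. pairing m (P r f) g"
  have "(\<integral>x. \<bar>f x\<bar> powr p \<partial>m) / p + (1 - 1 / p) * (\<integral>x. \<bar>g x\<bar> powr q \<partial>m)
      \<le> (\<integral>x. \<bar>f x\<bar> powr p \<partial>m) / p + (1 - 1 / p) * (\<integral>x. \<bar>f x\<bar> powr p \<partial>m)"
    unfolding g(2) using contraction[OF _ f] t p by (intro add_left_mono mult_left_mono) auto
  also have "\<dots> = (\<integral>x. \<bar>f x\<bar> powr p \<partial>m)" by (simp add: left_diff_distrib)
  finally obtain l where l: "\<And>r. a \<le> r \<Longrightarrow> \<bar>?h r - ?h t - (r - t) * l\<bar> \<le> curvature f a * (r - t)\<^sup>2"
    using pairing_orbit_differentiable[OF f g(1) _ a] unfolding curvature_def by blast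
  have approx: "approx_form m P s (P t f) g = (1 / s) * (?h t - ?h (t + s))" if s: "0 < s" for s
  proof -
    have Lp: "P s (P t f) \<in> Lp m p" "P (s + t) f \<in> Lp m p" using maps_Lp ut f s t by auto
    have "pairing m (\<lambda>x. P t f x - P s (P t f) x) g = ?h t - pairing m (P s (P t f)) g"
      using pairing_lincomb[OF ut Lp(1) g(1), of 1 "-1"] by simp
    also have "pairing m (P s (P t f)) g = ?h (s + t)"
      using add[of s t f] s t f by (intro pairing_cong_AE Lp g) auto
    finally show ?thesis by (simp add: approx_form_def add.commute)
  qed
  have lim: "((\<lambda>s. approx_form m P s (P t f) g) \<longlongrightarrow> - l) (at_right 0)"
  proof (rule LIM_zero_cancel, rule Lim_null_comparison)
    show "\<forall>\<^sub>F s in at_right 0. norm (approx_form m P s (P t f) g - - l) \<le> curvature f a * s"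
      using eventually_at_right_less[of 0]
    proof eventually_elim
      case (elim s)
      have "approx_form m P s (P t f) g - - l = - (1 / s) * (?h (t + s) - ?h t - s * l)"
        unfolding approx[OF elim] using elim by (simp add: algebra_simps)
      also have "norm \<dots> = (1 / s) * \<bar>?h (t + s) - ?h t - s * l\<bar>"
        using elim by (simp add: abs_mult)
      also have "\<dots> \<le> (1 / s) * (curvature f a * s\<^sup>2)"
        using l[of "t + s"] a elim by (intro mult_left_mono) auto
      also have "\<dots> = curvature f a * s" using elim by (simp add: power2_eq_square)
      finally show ?case .
    qed
    show "((\<lambda>s. curvature f a * s) \<longlongrightarrow> 0) (at_right 0)"
      by (rule tendsto_mult_right_zero) (rule tendsto_ident_at)
  qed
  have E: "p_form m P p (P t f) = - l"
    unfolding p_form_def using lim by (intro tendsto_Lim) (auto simp: g_def)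
  show "((\<lambda>s. approx_form m P s (P t f) g) \<longlongrightarrow> p_form m P p (P t f)) (at_right 0)"
    unfolding E by (rule lim)
  assume y: "a \<le> y"
  have uy: "P y f \<in> Lp m p" using maps_Lp[OF _ f] y a by simp
  have "(\<integral>x. \<bar>P t f x\<bar> powr p \<partial>m) + p * (?h y - ?h t)
      = (\<integral>x. \<bar>P t f x\<bar> powr p + p * (P y f x * g x - P t f x * g x) \<partial>m)"
    unfolding pairing_def
    using LpD(2)[OF ut] integrable_Lp_mult[OF p uy g(1)] integrable_Lp_mult[OF p ut g(1)] by simp
  also have "\<dots> \<le> (\<integral>x. \<bar>P y f x\<bar> powr p \<partial>m)"
  proof (rule integral_mono)
    show "integrable m (\<lambda>x. \<bar>P t f x\<bar> powr p + p * (P y f x * g x - P t f x * g x))"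
      using LpD(2)[OF ut] integrable_Lp_mult[OF p uy g(1)] integrable_Lp_mult[OF p ut g(1)] by auto
    show "\<bar>P t f x\<bar> powr p + p * (P y f x * g x - P t f x * g x) \<le> \<bar>P y f x\<bar> powr p" for x
      using abs_powr_subgradient[OF p, of "P t f x" "P y f x"] by (simp add: g_def algebra_simps)
  qed (rule LpD(2)[OF uy])
  finally have "(\<integral>x. \<bar>P t f x\<bar> powr p \<partial>m) + p * (?h y - ?h t) \<le> (\<integral>x. \<bar>P y f x\<bar> powr p \<partial>m)" .
  moreover have "p * ((y - t) * l - curvature f a * (y - t)\<^sup>2) \<le> p * (?h y - ?h t)"
    using l[OF y] p by (intro mult_left_mono) auto
  ultimately show "(\<integral>x. \<bar>P t f x\<bar> powr p \<partial>m) - p * (y - t) * p_form m P p (P t f)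
      - p * curvature f a * (y - t)\<^sup>2 \<le> (\<integral>x. \<bar>P y f x\<bar> powr p \<partial>m)"
    unfolding E by (simp add: algebra_simps)
qed

lemma orbit_in_p_form_domain:
  assumes "f \<in> Lp m p" "0 < t"
  shows "P t f \<in> p_form_domain m P p"
  unfolding p_form_domain_def using orbit_energy(1)[OF assms(1,2) order_refl] maps_Lp assms by auto

text \<open>Adding \<open>K t\<^sup>2\<close> absorbs the quadratic error and turns the inequality of \<open>orbit_energy\<close> into an exact subgradient
  inequality.\<close>
lemma energy_has_integral:
  assumes f: "f \<in> Lp m p" and ab: "0 < a" "a \<le> b"
  shows "((\<lambda>t. p * p_form m P p (P t f)) has_integral
    (\<integral>x. \<bar>P a f x\<bar> powr p \<partial>m) - (\<integral>x. \<bar>P b f x\<bar> powr p \<partial>m)) {a..b}"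
proof -
  define \<phi> where "\<phi> = (\<lambda>t. \<integral>x. \<bar>P t f x\<bar> powr p \<partial>m)"
  define E where "E = (\<lambda>t. p_form m P p (P t f))"
  define K where "K = p * curvature f a"
  have "((\<lambda>t. 2 * K * t - p * E t) has_integral (\<phi> b + K * b\<^sup>2) - (\<phi> a + K * a\<^sup>2)) {a..b}"
  proof (rule subgradient_has_integral[OF ab(2), where \<psi>="\<lambda>t. \<phi> t + K * t\<^sup>2"])
    fix x y assume "x \<in> {a..b}" "y \<in> {a..b}"
    then have "\<phi> x - p * (y - x) * E x - K * (y - x)\<^sup>2 \<le> \<phi> y"
      using orbit_energy(2)[OF f ab(1), of x y] by (auto simp: \<phi>_def E_def K_def)
    then show "\<phi> x + K * x\<^sup>2 + (y - x) * (2 * K * x - p * E x) \<le> \<phi> y + K * y\<^sup>2"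
      by (simp add: power2_eq_square algebra_simps)
  qed
  moreover have "((\<lambda>t. 2 * K * t) has_integral K * b\<^sup>2 - K * a\<^sup>2) {a..b}"
    by (rule fundamental_theorem_of_calculus[OF ab(2)])
      (auto intro!: derivative_eq_intros simp: has_real_derivative_iff_has_vector_derivative[symmetric])
  ultimately have "((\<lambda>t. 2 * K * t - (2 * K * t - p * E t)) has_integral
      (K * b\<^sup>2 - K * a\<^sup>2) - ((\<phi> b + K * b\<^sup>2) - (\<phi> a + K * a\<^sup>2))) {a..b}"
    by (rule has_integral_diff[rotated])
  then show ?thesis by (simp add: \<phi>_def E_def)
qed

lemma norm_antimono:
  assumes f: "f \<in> Lp m p" and "0 \<le> s" "s \<le> t"
  shows "(\<integral>x. \<bar>P t f x\<bar> powr p \<partial>m) \<le> (\<integral>x. \<bar>P s f x\<bar> powr p \<partial>m)"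
proof -
  have Lp: "P s f \<in> Lp m p" "P t f \<in> Lp m p" "P (t - s) (P s f) \<in> Lp m p"
    using maps_Lp assms by auto
  note [measurable] = Lp[THEN LpD(1)]
  have "(\<integral>x. \<bar>P t f x\<bar> powr p \<partial>m) = (\<integral>x. \<bar>P (t - s) (P s f) x\<bar> powr p \<partial>m)"
    by (rule integral_cong_AE) (use add[of "t - s" s f] assms in auto)
  also have "\<dots> \<le> (\<integral>x. \<bar>P s f x\<bar> powr p \<partial>m)" by (rule contraction) (use assms Lp in auto)
  finally show ?thesis .
qed

text \<open>The norms decrease along the orbit, so the subgradient inequality at \<open>t\<close> bounds the energy from
  below by \<open>- curvature f t * s\<close> for every \<open>s > 0\<close>.\<close>
lemma energy_nonneg:
  assumes f: "f \<in> Lp m p" and t: "0 < t"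
  shows "0 \<le> p_form m P p (P t f)"
proof -
  have "((\<lambda>s. - (curvature f t * s)) \<longlongrightarrow> 0) (at_right 0)"
    by (intro tendsto_eq_intros) (auto intro: tendsto_ident_at)
  moreover have "\<forall>\<^sub>F s in at_right 0. - (curvature f t * s) \<le> p_form m P p (P t f)"
    using eventually_at_right_less[of 0]
  proof eventually_elim
    case (elim s)
    have "- (p * s * p_form m P p (P t f)) - p * curvature f t * s\<^sup>2 \<le> 0"
      using orbit_energy(2)[OF f t order_refl, of "t + s"] norm_antimono[OF f, of t "t + s"] elim t by simp
    then have "(p * s) * (- (curvature f t * s)) \<le> (p * s) * p_form m P p (P t f)"
      by (simp add: power2_eq_square algebra_simps)
    moreover have "0 < p * s" using elim p by simp
    ultimately show ?case by (simp only: mult_le_cancel_left_pos)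
  qed
  ultimately show ?thesis by (rule tendsto_upperbound) simp
qed

text \<open>Exchanging the two times in \<open>orbit_energy\<close> shows that the energy increases at most linearly beyond any \<open>a > 0\<close>; a
  linear correction makes it monotone there.\<close>
lemma energy_measurable:
  assumes f: "f \<in> Lp m p"
  shows "(\<lambda>t. indicator {0<..} t * p_form m P p (P t f)) \<in> borel_measurable borel"
proof -
  define E where "E = (\<lambda>t. p_form m P p (P t f))"
  have "(\<lambda>t. indicator {a..} t * E t) \<in> borel_measurable borel" if a: "0 < a" for a
  proof -
    let ?c = "2 * curvature f a"
    have "mono_on {a..} (\<lambda>t. ?c * t - E t)"
    proof (rule mono_onI)
      fix x y assume xy: "x \<in> {a..}" "y \<in> {a..}" "x \<le> y"
      show "?c * x - E x \<le> ?c * y - E y"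
      proof (cases "x = y")
        case False
        have "(p * (y - x)) * (E y - E x) \<le> (p * (y - x)) * (?c * (y - x))"
          using orbit_energy(2)[OF f a, of x y] orbit_energy(2)[OF f a, of y x] xy
          by (simp add: E_def power2_eq_square algebra_simps)
        then have "E y - E x \<le> ?c * (y - x)" using False xy p by simp
        then show ?thesis by (simp add: algebra_simps)
      qed simp
    qed
    then have "(\<lambda>t. ?c * t - E t) \<in> borel_measurable (restrict_space borel {a..})"
      by (rule borel_measurable_mono_on_fnc)
    then have "(\<lambda>t. indicator {a..} t * (?c * t - E t)) \<in> borel_measurable borel"
      by (subst (asm) borel_measurable_restrict_space_iff) auto
    then have "(\<lambda>t. indicator {a..} t * (?c * t) - indicator {a..} t * (?c * t - E t)) \<in> borel_measurable borel"
      by measurable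
    then show ?thesis by (simp add: right_diff_distrib)
  qed
  then have meas: "(\<lambda>t. indicator {1 / Suc n..} t * E t) \<in> borel_measurable borel" for n by simp
  have "(\<lambda>t. indicator {0<..} t * E t) \<in> borel_measurable borel"
  proof (rule borel_measurable_LIMSEQ_real[OF _ meas])
    fix t :: real
    show "(\<lambda>n. indicator {1 / Suc n..} t * E t) \<longlonglongrightarrow> indicator {0<..} t * E t"
    proof (cases "0 < t")
      case True
      then obtain N where N: "1 / Suc N < t" using nat_approx_posE by blast
      have "indicator {1 / Suc n..} t * E t = indicator {0<..} t * E t" if "N \<le> n" for n
      proof -
        have "1 / real (Suc n) \<le> 1 / Suc N" using that by (intro divide_left_mono) auto
        then show ?thesis using N True by (simp add: indicator_def)
      qed
      then show ?thesis by (intro tendsto_eventually) (auto simp: eventually_sequentially)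
    next
      case False
      then have "\<not> 1 / real (Suc n) \<le> t" for n
        using divide_pos_pos[of 1 "real (Suc n)"] by linarith
      then show ?thesis using False by (simp add: indicator_def)
    qed
  qed
  then show ?thesis by (simp add: E_def)
qed

text \<open>The norms at positive times are at most the initial one, and the subgradient inequality at \<open>f\<close>
  gives a lower bound tending to it.\<close>
lemma norm_orbit_tendsto:
  assumes f: "f \<in> Lp m p"
  shows "((\<lambda>t. \<integral>x. \<bar>P t f x\<bar> powr p \<partial>m) \<longlongrightarrow> (\<integral>x. \<bar>f x\<bar> powr p \<partial>m)) (at_right 0)"
proof -
  define g where "g = (\<lambda>x. signed_powr (f x) (p - 1))"
  have g: "g \<in> Lp m q" using signed_powr_Lp[OF p f] by (simp add: g_def)
  have "((\<lambda>t. pairing m (\<lambda>x. P t f x - f x) g) \<longlongrightarrow> 0) (at_right 0)"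
    by (rule pairing_tendsto_0[OF _ g _ continuous[OF f], where I="{0<..}"])
      (use p f eventually_at_right_less[of 0] in \<open>auto intro!: Lp_diff maps_Lp\<close>)
  then have "((\<lambda>t. (\<integral>x. \<bar>f x\<bar> powr p \<partial>m) + p * pairing m (\<lambda>x. P t f x - f x) g)
      \<longlongrightarrow> (\<integral>x. \<bar>f x\<bar> powr p \<partial>m) + p * 0) (at_right 0)"
    by (intro tendsto_intros)
  then have lower: "((\<lambda>t. (\<integral>x. \<bar>f x\<bar> powr p \<partial>m) + p * pairing m (\<lambda>x. P t f x - f x) g)
      \<longlongrightarrow> (\<integral>x. \<bar>f x\<bar> powr p \<partial>m)) (at_right 0)" by simp
  show ?thesis
  proof (rule tendsto_sandwich[OF _ _ lower tendsto_const])
    show "\<forall>\<^sub>F t in at_right 0. (\<integral>x. \<bar>f x\<bar> powr p \<partial>m) + p * pairing m (\<lambda>x. P t f x - f x) g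
        \<le> (\<integral>x. \<bar>P t f x\<bar> powr p \<partial>m)"
      using eventually_at_right_less[of 0]
    proof eventually_elim
      case (elim t)
      have u: "P t f \<in> Lp m p" using maps_Lp f elim by simp
      have "(\<lambda>x. P t f x - f x) \<in> Lp m p" by (rule Lp_diff[OF _ u f]) (use p in simp)
      then have int: "integrable m (\<lambda>x. (P t f x - f x) * g x)"
        by (rule integrable_Lp_mult[OF p _ g])
      have "(\<integral>x. \<bar>f x\<bar> powr p \<partial>m) + p * pairing m (\<lambda>x. P t f x - f x) g
          = (\<integral>x. \<bar>f x\<bar> powr p + p * ((P t f x - f x) * g x) \<partial>m)"
        unfolding pairing_def using LpD(2)[OF f] int by simp
      also have "\<dots> \<le> (\<integral>x. \<bar>P t f x\<bar> powr p \<partial>m)"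
      proof (rule integral_mono[OF _ LpD(2)[OF u]])
        show "\<bar>f x\<bar> powr p + p * ((P t f x - f x) * g x) \<le> \<bar>P t f x\<bar> powr p" for x
          using abs_powr_subgradient[OF p, of "f x" "P t f x"] by (simp add: g_def mult.commute)
      qed (use LpD(2)[OF f] int in auto)
      finally show ?case .
    qed
    show "\<forall>\<^sub>F t in at_right 0. (\<integral>x. \<bar>P t f x\<bar> powr p \<partial>m) \<le> (\<integral>x. \<bar>f x\<bar> powr p \<partial>m)"
      using eventually_at_right_less[of 0] by eventually_elim (use contraction f in auto)
  qed
qed

text \<open>Monotone convergence along the intervals \<open>[1 / (n + 1), n + 1]\<close>: the boundary terms tend to \<open>\<integral>\<bar>f\<bar>\<^sup>p\<close> by strong
  continuity and to \<open>0\<close> by stability.\<close>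
lemma hardy_stein:
  assumes f: "f \<in> Lp m p"
    and stable: "((\<lambda>t. \<integral>x. \<bar>P t f x\<bar> powr p \<partial>m) \<longlongrightarrow> 0) at_top"
  shows "set_integrable lborel {0<..} (\<lambda>t. p_form m P p (P t f))"
    and "(\<integral>x. \<bar>f x\<bar> powr p \<partial>m) = p * (LBINT t:{0<..}. p_form m P p (P t f))"
proof -
  define \<phi> where "\<phi> = (\<lambda>t. \<integral>x. \<bar>P t f x\<bar> powr p \<partial>m)"
  define E where "E = (\<lambda>t. p * (indicator {0<..} t * p_form m P p (P t f)))"
  define I where "I = (\<lambda>n. {1 / Suc n..real (Suc n)})"
  have E[measurable]: "E \<in> borel_measurable borel" "\<And>t. 0 \<le> E t"
    using energy_measurable[OF f] energy_nonneg[OF f] p by (auto simp: E_def indicator_def)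
  define F where "F = (\<lambda>n t. indicator (I n) t * E t)"
  have I_pos: "0 < t" if "t \<in> I n" for t n
  proof -
    have "0 < 1 / real (Suc n)" by simp
    also have "\<dots> \<le> t" using that by (simp add: I_def)
    finally show ?thesis .
  qed
  have F: "has_bochner_integral lborel (F n) (\<phi> (1 / Suc n) - \<phi> (Suc n))" for n
  proof (rule has_bochner_integral_nn_integral)
    have "1 / real (Suc n) \<le> 1" by simp
    then have le: "1 / real (Suc n) \<le> real (Suc n)" by linarith
    have "((\<lambda>t. p * p_form m P p (P t f)) has_integral \<phi> (1 / Suc n) - \<phi> (Suc n)) (I n)"
      unfolding I_def \<phi>_def by (rule energy_has_integral[OF f _ le]) simp
    then have "((\<lambda>t. if t \<in> I n then p * p_form m P p (P t f) else 0) has_integral \<phi> (1 / Suc n) - \<phi> (Suc n)) UNIV"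
      by (simp add: has_integral_restrict_UNIV)
    moreover have "(\<lambda>t. if t \<in> I n then p * p_form m P p (P t f) else 0) = F n"
      using I_pos by (auto simp: F_def E_def indicator_def)
    ultimately have "(F n has_integral \<phi> (1 / Suc n) - \<phi> (Suc n)) UNIV" by simp
    moreover have [measurable]: "F n \<in> borel_measurable borel" unfolding F_def I_def by measurable
    ultimately show "(\<integral>\<^sup>+t. F n t \<partial>lborel) = ennreal (\<phi> (1 / Suc n) - \<phi> (Suc n))"
      using E(2) by (intro nn_integral_has_integral_lborel) (auto simp: F_def)
    show "F n \<in> borel_measurable lborel" by simp
    show "0 \<le> \<phi> (1 / Suc n) - \<phi> (Suc n)"
      using norm_antimono[OF f _ le] by (simp add: \<phi>_def)
  qed (use E(2) in \<open>auto simp: F_def\<close>)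
  have "(\<lambda>n. \<phi> (1 / Suc n) - \<phi> (Suc n)) \<longlonglongrightarrow> (\<integral>x. \<bar>f x\<bar> powr p \<partial>m) - 0"
  proof (rule tendsto_diff)
    have "filterlim (\<lambda>n. 1 / real (Suc n)) (at_right 0) sequentially"
      using LIMSEQ_inverse_real_of_nat
      by (auto simp: filterlim_at inverse_eq_divide)
    then show "(\<lambda>n. \<phi> (1 / Suc n)) \<longlonglongrightarrow> (\<integral>x. \<bar>f x\<bar> powr p \<partial>m)"
      unfolding \<phi>_def by (rule filterlim_compose[OF norm_orbit_tendsto[OF f]])
    have "filterlim (\<lambda>n. real (Suc n)) at_top sequentially"
      by (rule filterlim_compose[OF filterlim_real_sequentially filterlim_Suc])
    then show "(\<lambda>n. \<phi> (Suc n)) \<longlonglongrightarrow> 0"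
      unfolding \<phi>_def by (rule filterlim_compose[OF stable])
  qed
  then have lim: "(\<lambda>n. integral\<^sup>L lborel (F n)) \<longlonglongrightarrow> (\<integral>x. \<bar>f x\<bar> powr p \<partial>m)"
    by (simp only: has_bochner_integral_integral_eq[OF F] diff_zero)
  have "has_bochner_integral lborel E (\<integral>x. \<bar>f x\<bar> powr p \<partial>m)"
  proof (rule has_bochner_integral_monotone_convergence[OF _ _ _ lim])
    show "integrable lborel (F n)" for n using F[of n] by (simp add: has_bochner_integral_iff)
    show "AE t in lborel. mono (\<lambda>n. F n t)"
    proof (rule AE_I2, rule monoI)
      fix t and i j :: nat assume "i \<le> j"
      then have "1 / real (Suc j) \<le> 1 / Suc i" "real (Suc i) \<le> Suc j"
        by (auto intro!: divide_left_mono)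
      then have "I i \<subseteq> I j" unfolding I_def by (auto simp del: of_nat_Suc)
      then show "F i t \<le> F j t" using E(2)[of t] by (auto simp: F_def indicator_def)
    qed
    show "AE t in lborel. (\<lambda>n. F n t) \<longlonglongrightarrow> E t"
    proof (rule AE_I2)
      fix t :: real
      show "(\<lambda>n. F n t) \<longlonglongrightarrow> E t"
      proof (cases "0 < t")
        case True
        obtain N1 where N1: "1 / Suc N1 < t" using True nat_approx_posE by blast
        obtain N2 :: nat where N2: "t \<le> N2" using real_arch_simple by blast
        have "F n t = E t" if "max N1 N2 \<le> n" for n
        proof -
          have "1 / real (Suc n) \<le> 1 / Suc N1" "real N2 \<le> real (Suc n)"
            using that by (auto intro!: divide_left_mono)
          then have "t \<in> I n" using N1 N2 unfolding I_def by (auto simp del: of_nat_Suc)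
          then show ?thesis by (simp add: F_def)
        qed
        then show ?thesis by (intro tendsto_eventually eventually_sequentiallyI[of "max N1 N2"])
      next
        case False
        then show ?thesis by (simp add: F_def E_def)
      qed
    qed
  qed simp
  then have "has_bochner_integral lborel (\<lambda>t. (1 / p) * E t) ((1 / p) * (\<integral>x. \<bar>f x\<bar> powr p \<partial>m))"
    by (rule has_bochner_integral_mult_right)
  moreover have "(\<lambda>t. (1 / p) * E t) = (\<lambda>t. indicator {0<..} t *\<^sub>R p_form m P p (P t f))"
    using p by (simp add: E_def)
  ultimately have main: "has_bochner_integral lborel (\<lambda>t. indicator {0<..} t *\<^sub>R p_form m P p (P t f))
      ((1 / p) * (\<integral>x. \<bar>f x\<bar> powr p \<partial>m))" by simp
  then show "set_integrable lborel {0<..} (\<lambda>t. p_form m P p (P t f))"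
    unfolding set_integrable_def by (simp add: has_bochner_integral_iff)
  show "(\<integral>x. \<bar>f x\<bar> powr p \<partial>m) = p * (LBINT t:{0<..}. p_form m P p (P t f))"
    using main p unfolding set_lebesgue_integral_def by (simp add: has_bochner_integral_integral_eq)
qed

end

section \<open>The Hardy--Stein identity for the semigroup of a Dirichlet form\<close>
lemma symmetric_markov_semigroupI:
  assumes p: "1 < p"
    and contraction: "\<And>r. 1 \<le> r \<Longrightarrow> sc_contraction_semigroup m r P"
    and symmetric: "symmetric_semigroup m P"
    and markovian: "markovian_semigroup m P"
  shows "symmetric_markov_semigroup m p P"
proof (rule symmetric_markov_semigroup.intro)
  have p1: "1 \<le> p" "0 < p" using p by auto
  note sc = contraction[unfolded sc_contraction_semigroup_def]
  note maps = sc[THEN conjunct1, rule_format]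
  note linear = sc[THEN conjunct2, THEN conjunct1, rule_format]
  note norm_le = sc[THEN conjunct2, THEN conjunct2, THEN conjunct1, rule_format]
  note zero = sc[THEN conjunct2, THEN conjunct2, THEN conjunct2, THEN conjunct1, rule_format]
  note add = sc[THEN conjunct2, THEN conjunct2, THEN conjunct2, THEN conjunct2, THEN conjunct1, rule_format]
  note cont = sc[THEN conjunct2, THEN conjunct2, THEN conjunct2, THEN conjunct2, THEN conjunct2, rule_format]
  show "symmetric_submarkov m p (P t)" if t: "0 \<le> t" for t
  proof
    show "1 < p" by (rule p)
    show "P t f \<in> Lp m p" if "f \<in> Lp m p" for f
      by (rule maps[OF p1(1) t that])
    show "AE x in m. P t (\<lambda>y. a * f y + b * g y) x = a * P t f x + b * P t g x"
      if "f \<in> Lp m p" "g \<in> Lp m p" for f g a b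
      by (rule linear[OF p1(1) t that])
    show "(\<integral>x. \<bar>P t f x\<bar> powr p \<partial>m) \<le> (\<integral>x. \<bar>f x\<bar> powr p \<partial>m)" if "f \<in> Lp m p" for f
      using norm_le[OF p1(1) t that] p1 by (simp add: Lp_norm_le_iff)
  next
    fix A assume A: "A \<in> sets m" "emeasure m A < \<infinity>"
    have ind: "indicator A \<in> Lp m r" for r by (rule Lp_indicator[OF A])
    show bounds: "AE x in m. 0 \<le> P t (indicator A) x \<and> P t (indicator A) x \<le> 1"
      using markovian t ind unfolding markovian_semigroup_def by auto
    have L1: "P t (indicator A) \<in> Lp m 1"
      "Lp_norm m 1 (P t (indicator A)) \<le> Lp_norm m 1 (indicator A)"
      using maps[OF order_refl t ind] norm_le[OF order_refl t ind] by simp_all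
    note [measurable] = LpD(1)[OF L1(1)]
    show int: "integrable m (P t (indicator A))"
      using LpD(2)[OF L1(1)] by (subst integrable_abs_iff[symmetric]) auto
    have "(\<integral>x. P t (indicator A) x \<partial>m) = (\<integral>x. \<bar>P t (indicator A) x\<bar> powr 1 \<partial>m)"
      by (rule integral_cong_AE) (use bounds in auto)
    also have "\<dots> \<le> (\<integral>x. \<bar>indicator A x\<bar> powr 1 \<partial>m)"
      using L1(2) by (subst (asm) Lp_norm_le_iff) auto
    also have "\<dots> = measure m A" using A by simp
    finally show "(\<integral>x. P t (indicator A) x \<partial>m) \<le> measure m A" .
    fix B assume B: "B \<in> sets m" "emeasure m B < \<infinity>"
    have "pairing m (P t (indicator A)) (indicator B) = pairing m (indicator A) (P t (indicator B))"
      using symmetric t ind Lp_indicator[OF B] unfolding symmetric_semigroup_def by blast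
    then show "(\<integral>x. P t (indicator A) x * indicator B x \<partial>m) = (\<integral>x. P t (indicator B) x * indicator A x \<partial>m)"
      by (simp add: pairing_def mult.commute)
  qed
  show "AE x in m. P 0 f x = f x" if "f \<in> Lp m p" for f
    by (rule zero[OF p1(1) that])
  show "AE x in m. P (s + t) f x = P s (P t f) x" if "0 \<le> s" "0 \<le> t" "f \<in> Lp m p" for s t f
    by (rule add[OF p1(1) that])
  show "((\<lambda>t. \<integral>x. \<bar>P t f x - f x\<bar> powr p \<partial>m) \<longlongrightarrow> 0) (at_right 0)" if "f \<in> Lp m p" for f
    using cont[OF p1(1) that] p1 by (simp add: Lp_norm_tendsto_0_iff)
qed

theorem theorem3p1:
  fixes m :: "'a::metric_space measure"
    and D :: "('a \<Rightarrow> real) set"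
    and \<E> :: "('a \<Rightarrow> real) \<Rightarrow> ('a \<Rightarrow> real) \<Rightarrow> real"
    and P :: "real \<Rightarrow> ('a \<Rightarrow> real) \<Rightarrow> 'a \<Rightarrow> real"
    and p :: real
    and f :: "'a \<Rightarrow> real"
  assumes "locally_compact_space (euclidean :: 'a topology)"
    and "separable_space (euclidean :: 'a topology)"
    and "radon_measure m"
    and "measure_support m = UNIV"
    and "regular_dirichlet_form m D \<E>"
    and "associated_semigroup m D \<E> P"
    and "conservative m P"
    and "1 < p"
    and "\<forall>g\<in>Lp m p. ((\<lambda>T. Lp_norm m p (P T g)) \<longlongrightarrow> 0) at_top"
    and "f \<in> Lp m p"
  shows "(\<forall>t>0. P t f \<in> p_form_domain m P p) \<and>
         set_integrable lborel {0<..} (\<lambda>t. p_form m P p (P t f)) \<and>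
         (\<integral>x. \<bar>f x\<bar> powr p \<partial>m) = p * (LBINT t:{0<..}. p_form m P p (P t f))"
proof -
  interpret symmetric_markov_semigroup m p P
    using assms(6,8) unfolding associated_semigroup_def
    by (intro symmetric_markov_semigroupI) auto
  have "((\<lambda>T. \<integral>x. \<bar>P T f x\<bar> powr p \<partial>m) \<longlongrightarrow> 0) at_top"
    using assms(8-10) by (simp add: Lp_norm_tendsto_0_iff)
  from hardy_stein[OF assms(10) this] orbit_in_p_form_domain[OF assms(10)]
  show ?thesis by blast
qed

end
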